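(* Let $M$ be a loopless matroid of rank $k$ on a ground set $E$ with $m$ elements, and let $\epsilon\in E$ be arbitrary. Then $$\big(-\operatorname{Trop}(M)\big)\cdot\operatorname{Trop}(U_{m,m-k+1})\cdot\operatorname{Trop}(y_\epsilon-1)=\operatorname{nbc}(M),$$ where $U_{m,m-k+1}$ is the uniform matroid of rank $m-k+1$ on $E$, $\operatorname{Trop}(y_\epsilon-1)=\{y\in\mathbb{R}^E: y_\epsilon=0\}$ with multiplicity one, $\cdot$ is the tropical intersection product in $\mathbb{R}^E$, and $\operatorname{nbc}(M)$ is the number of nbc-bases of $M$.
   Context: **nbc-bases.** For a matroid $M$ with a fixed total order on its ground set, a broken circuit is a set $C\setminus\{\min C\}$ with $C$ a circuit of $M$; an nbc-basis is a basis containing no broken circuit. The number $\operatorname{nbc}(M)$ of nbc-bases does not depend on the total order. **Bergman fan.** For a loopless matroid $M$ on $E$, a proper chain of flats is $\mathcal F=(F_1\subsetneq\dots\subsetneq F_s)$ with all $F_i$ flats different from $\emptyset$ and $E$ (possibly $s=0$). Put $\chi_S=\sum_{e\in S}\chi_e\in\mathbb{R}^E$ for $S\subseteq E$ and $\sigma_{\mathcal F}=\operatorname{cone}(\chi_{F_1},\dots,\chi_{F_s})+\mathbb{R}\cdot\chi_E$. The Bergman fan $\operatorname{Trop}(M)$ is the fan of all cones $\sigma_{\mathcal F}$, every maximal cone having multiplicity one. $-\operatorname{Trop}(M)$ is its image under $v\mapsto -v$, with the same multiplicities. **Tropical intersection product.** For a polyhedron $\eta\subseteq\mathbb{R}^m$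 with $u\in\eta$, let $N_\eta=\mathbb{Z}^m\cap\operatorname{Span}(\eta-u)$. A weighted polyhedral complex is a polyhedral complex with positive integer multiplicities on its maximal cells; a pure $d$-dimensional one is balanced if for every $(d-1)$-dimensional cell $\tau$, $\sum_{\sigma\supsetneq\tau}\operatorname{mult}(\sigma)v_\sigma\in N_\tau$, where $\sigma$ runs over $d$-dimensional cells and $v_\sigma\in\mathbb{Z}^m$ is a vector (pointing from $\tau$ into $\sigma$) with $\mathbb{Z}v_\sigma+N_\tau=N_\sigma$. The stable intersection of balanced complexes $\Sigma_1,\Sigma_2$ in $\mathbb{R}^m$ is $\Sigma_1\wedge\Sigma_2=\{\sigma_1\cap\sigma_2 : \sigma_i\in\Sigma_i,\ \dim(\sigma_1+\sigma_2)=m\}$, where a top-dimensional cell $\sigma_1\cap\sigma_2$ has multiplicity $\sum_{\tau_1,\tau_2}\operatorname{mult}_{\Sigma_1}(\tau_1)\operatorname{mult}_{\Sigma_2}(\tau_2)[\mathbb{Z}^m:N_{\tau_1}+N_{\tau_2}]$, the sum over maximal cells $\tau_i\in\Sigma_i$ containing $\sigma_1\cap\sigma_2$ with $\tau_1\cap(\tau_2+\varepsilon v)\neq\emptyset$ for a fixed generic $v\in\mathbb{R}^m$ and all sufficiently small $\varepsilon>0$ (this does not depend on $v$). It is associative and the result is balanced (or empty). If $\Sigma_1,\dots,\Sigma_k$ are balanced with $\sum\operatorname{codim}\Sigma_i=m$, their tropical intersection product $\Sigma_1\cdot\ldots\cdot\Sigma_k$ is the number of points of $\Sigma_1\wedge\dots\wedge\Sigma_k$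 counted with multiplicity. *)

theory Defs
  imports "HOL-Analysis.Analysis"
begin

section \<open>Matroids\<close>

text \<open>
  A matroid on the ground set \<open>UNIV :: 'e set\<close>, with \<open>'e\<close> a finite type, is given by its family
  of independent sets.
\<close>

definition matroid :: "'e::finite set set \<Rightarrow> bool" where
  "matroid M \<longleftrightarrow> {} \<in> M \<and> (\<forall>A\<in>M. \<forall>B. B \<subseteq> A \<longrightarrow> B \<in> M) \<and>
     (\<forall>A\<in>M. \<forall>B\<in>M. card A < card B \<longrightarrow> (\<exists>x\<in>B - A. insert x A \<in> M))"

definition loopless :: "'e::finite set set \<Rightarrow> bool" where
  "loopless M \<longleftrightarrow> (\<forall>x. {x} \<in> M)"

definition matroid_rank :: "'e::finite set set \<Rightarrow> 'e set \<Rightarrow> nat" where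
  "matroid_rank M S = Max {card A |A. A \<in> M \<and> A \<subseteq> S}"

definition matroid_bases :: "'e::finite set set \<Rightarrow> 'e set set" where
  "matroid_bases M = {B \<in> M. \<forall>A\<in>M. B \<subseteq> A \<longrightarrow> A = B}"

definition circuits :: "'e::finite set set \<Rightarrow> 'e set set" where
  "circuits M = {C. C \<notin> M \<and> (\<forall>A. A \<subset> C \<longrightarrow> A \<in> M)}"

definition flats :: "'e::finite set set \<Rightarrow> 'e set set" where
  "flats M = {F. \<forall>x. x \<notin> F \<longrightarrow> matroid_rank M F < matroid_rank M (insert x F)}"

definition uniform_matroid :: "nat \<Rightarrow> 'e::finite set set" where
  "uniform_matroid r = {A. card A \<le> r}"

text \<open>The relation \<open>r\<close> is a reflexive total order on the ground set; \<open>(a, b) \<in> r\<close> reads \<open>a \<le> b\<close>.\<close>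

definition broken_circuits :: "'e rel \<Rightarrow> 'e::finite set set \<Rightarrow> 'e set set" where
  "broken_circuits r M = {C - {c} |C c. C \<in> circuits M \<and> c \<in> C \<and> (\<forall>x\<in>C. (c, x) \<in> r)}"

definition nbc_bases :: "'e rel \<Rightarrow> 'e::finite set set \<Rightarrow> 'e set set" where
  "nbc_bases r M = {B \<in> matroid_bases M. \<not> (\<exists>D\<in>broken_circuits r M. D \<subseteq> B)}"

definition nbc :: "'e rel \<Rightarrow> 'e::finite set set \<Rightarrow> nat" where
  "nbc r M = card (nbc_bases r M)"


section \<open>Stable intersection and tropical intersection product\<close>

text \<open>
  A weighted polyhedral complex. Only the weights of the maximal cells are meaningful. The
  operations below are total functions given by the usual formulas; they have their usual
  meaning for balanced complexes.
\<close>

record 'v wcomplex =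
  cells :: "'v set set"
  weight :: "'v set \<Rightarrow> nat"

definition maximal_cells :: "'v wcomplex \<Rightarrow> 'v set set" where
  "maximal_cells \<Sigma> = {\<sigma> \<in> cells \<Sigma>. \<forall>\<tau>\<in>cells \<Sigma>. \<sigma> \<subseteq> \<tau> \<longrightarrow> \<tau> = \<sigma>}"

definition integer_vectors :: "(real ^ 'n::finite) set" where
  "integer_vectors = {z. \<forall>i. z $ i \<in> \<int>}"

text \<open>This is \<open>Span(\<eta> - u)\<close> for any choice of \<open>u \<in> \<eta>\<close>.\<close>

definition direction_space :: "(real ^ 'n::finite) set \<Rightarrow> (real ^ 'n) set" where
  "direction_space \<eta> = span {x - u |x u. x \<in> \<eta> \<and> u \<in> \<eta>}"

definition cell_lattice :: "(real ^ 'n::finite) set \<Rightarrow> (real ^ 'n) set" where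
  "cell_lattice \<eta> = integer_vectors \<inter> direction_space \<eta>"

text \<open>
  The index of a subgroup \<open>N\<close> of the integer lattice, as the number of its cosets
  (\<open>0\<close> if the index is infinite).
\<close>

definition lattice_index :: "(real ^ 'n::finite) set \<Rightarrow> nat" where
  "lattice_index N = card ((\<lambda>z. (+) z ` N) ` integer_vectors)"

text \<open>
  Genericity of the displacement: \<open>v\<close> avoids the finitely many proper linear subspaces spanned
  by the directions of a pair of non-transversal cells. On sets, \<open>+\<close> is the Minkowski sum.
\<close>

definition generic_displacement ::
    "(real ^ 'n::finite) wcomplex \<Rightarrow> (real ^ 'n) wcomplex \<Rightarrow> real ^ 'n \<Rightarrow> bool" where
  "generic_displacement \<Sigma>1 \<Sigma>2 v \<longleftrightarrow>
     (\<forall>\<sigma>1\<in>cells \<Sigma>1. \<forall>\<sigma>2\<in>cells \<Sigma>2.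
        aff_dim (\<sigma>1 + \<sigma>2) < int CARD('n) \<longrightarrow> v \<notin> direction_space (\<sigma>1 + \<sigma>2))"

definition displaced_multiplicity ::
    "(real ^ 'n::finite) wcomplex \<Rightarrow> (real ^ 'n) wcomplex \<Rightarrow> real ^ 'n \<Rightarrow> (real ^ 'n) set \<Rightarrow> nat" where
  "displaced_multiplicity \<Sigma>1 \<Sigma>2 v \<sigma> =
     (\<Sum>(\<tau>1, \<tau>2) \<in> {(\<tau>1, \<tau>2). \<tau>1 \<in> maximal_cells \<Sigma>1 \<and> \<tau>2 \<in> maximal_cells \<Sigma>2 \<and>
          \<sigma> \<subseteq> \<tau>1 \<and> \<sigma> \<subseteq> \<tau>2 \<and>
          (\<forall>\<^sub>F \<epsilon> in at_right (0::real). \<tau>1 \<inter> (+) (\<epsilon> *\<^sub>R v) ` \<tau>2 \<noteq> {})}.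
        weight \<Sigma>1 \<tau>1 * weight \<Sigma>2 \<tau>2 * lattice_index (cell_lattice \<tau>1 + cell_lattice \<tau>2))"

text \<open>
  One unspecified generic displacement is fixed for each pair of complexes. The empty set is
  not regarded as a cell.
\<close>

definition stable_intersection ::
    "(real ^ 'n::finite) wcomplex \<Rightarrow> (real ^ 'n) wcomplex \<Rightarrow> (real ^ 'n) wcomplex" where
  "stable_intersection \<Sigma>1 \<Sigma>2 =
     \<lparr>cells = {\<sigma>1 \<inter> \<sigma>2 |\<sigma>1 \<sigma>2. \<sigma>1 \<in> cells \<Sigma>1 \<and> \<sigma>2 \<in> cells \<Sigma>2 \<and>
                \<sigma>1 \<inter> \<sigma>2 \<noteq> {} \<and> aff_dim (\<sigma>1 + \<sigma>2) = int CARD('n)},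
      weight = displaced_multiplicity \<Sigma>1 \<Sigma>2 (SOME v. generic_displacement \<Sigma>1 \<Sigma>2 v)\<rparr>"

definition weighted_point_count :: "'v wcomplex \<Rightarrow> nat" where
  "weighted_point_count \<Sigma> = (\<Sum>p | {p} \<in> cells \<Sigma>. weight \<Sigma> {p})"

text \<open>Meaningful for nonempty lists with codimensions summing to \<open>CARD('n)\<close>; iterated stable intersections are bracketed to the left.\<close>

definition tropical_product :: "(real ^ 'n::finite) wcomplex list \<Rightarrow> nat" where
  "tropical_product \<Sigma>s = weighted_point_count (foldl stable_intersection (hd \<Sigma>s) (tl \<Sigma>s))"


section \<open>The fans\<close>

definition char_vec :: "'e set \<Rightarrow> real ^ 'e::finite" where
  "char_vec S = (\<Sum>e\<in>S. axis e 1)"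

text \<open>A proper chain of flats is encoded by its set of members.\<close>

definition proper_flat_chain :: "'e::finite set set \<Rightarrow> 'e set set \<Rightarrow> bool" where
  "proper_flat_chain M \<F> \<longleftrightarrow> subset.chain (flats M - {{}, UNIV}) \<F>"

definition chain_cone :: "'e::finite set set \<Rightarrow> (real ^ 'e) set" where
  "chain_cone \<F> = convex_cone hull (char_vec ` \<F>) + span {char_vec UNIV}"

definition Trop :: "'e::finite set set \<Rightarrow> (real ^ 'e) wcomplex" where
  "Trop M = \<lparr>cells = {chain_cone \<F> |\<F>. proper_flat_chain M \<F>}, weight = (\<lambda>_. 1)\<rparr>"

definition reflect :: "(real ^ 'e::finite) wcomplex \<Rightarrow> (real ^ 'e) wcomplex" where
  "reflect \<Sigma> = \<lparr>cells = (`) uminus ` cells \<Sigma>, weight = (\<lambda>\<sigma>. weight \<Sigma> (uminus ` \<sigma>))\<rparr>"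

definition Trop_coordinate :: "'e::finite \<Rightarrow> (real ^ 'e) wcomplex" where
  "Trop_coordinate \<epsilon> = \<lparr>cells = {{y. y $ \<epsilon> = 0}}, weight = (\<lambda>_. 1)\<rparr>"

end

theory Submission
  imports Defs
begin

text \<open>
  Let \<open>v\<close> be a generic displacement and \<open>w = -v\<close>. The cells \<open>-\<sigma>\<^sub>F\<close> and \<open>\<sigma>\<^sub>G + \<epsilon> v\<close> meet for small
  \<open>\<epsilon> > 0\<close> exactly when \<open>w\<close> lies in \<open>\<sigma>\<^sub>F + \<sigma>\<^sub>G\<close>. So the stable intersection of the two fans
  counts the ways to write \<open>w = x + y\<close> with \<open>x\<close> in the Bergman fan of \<open>M\<close> and \<open>y\<close> in that of
  \<open>U\<^sub>m\<^sub>,\<^sub>m\<^sub>-\<^sub>k\<^sub>+\<^sub>1\<close>, up to moving constants from one summand to the other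
  (\<open>displaced_cells_eq_decomposition_cones\<close>). It is supported on the line of constant vectors, which
  the hyperplane \<open>y\<^sub>\<epsilon> = 0\<close> meets transversally in the origin with index one.

  Normalize \<open>min y = 0\<close>. Membership in the fan of the uniform matroid says that \<open>y\<close> vanishes on at least
  \<open>k\<close> elements. Genericity forces the set \<open>B\<close> of these elements to be a basis of \<open>M\<close> on which \<open>x\<close> is
  injective (\<open>transversal_pair_structure\<close>). On \<open>B\<close> we have \<open>x = w\<close>, and as \<open>x\<close> attains its minimum on every
  circuit at least twice, its value at \<open>e\<close> outside \<open>B\<close> is the minimum of \<open>w\<close> over the rest of the fundamental
  circuit of \<open>e\<close>. So \<open>B\<close> determines the decomposition, and the remaining condition \<open>y \<ge> 0\<close> says
  that \<open>e\<close> is never the \<open>w\<close>-smallest element of its fundamental circuit, that is, that \<open>B\<close> is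
  an nbc-basis for the order of the ground set by \<open>w\<close>-values (\<open>card_decompositions\<close>). All
  lattice indices are one, because the level sets of \<open>x\<close> are represented by \<open>B\<close> and those of \<open>y\<close> other
  than \<open>B\<close> are singletons (\<open>decompositions_lattice_index\<close>).

  This gives the number of nbc-bases for one particular order. Whitney's broken circuit theorem,
  \<open>nbc_eq_sign_sum\<close>, shows that this number does not depend on the order.

  The cones are handled through a description by inequalities: \<open>x\<close> lies in \<open>\<sigma>\<^sub>F\<close> if and only if, whenever
  \<open>x\<^sub>e < x\<^sub>f\<close>, some member of the chain \<open>F\<close> contains \<open>f\<close> but not \<open>e\<close> (\<open>chain_cone_separates\<close>,
  \<open>mem_chain_coneI\<close>). Hence \<open>x\<close> lies in the Bergman fan if and only if its superlevel sets are flats.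
\<close>


section \<open>Bases, circuits and flats of a matroid\<close>

lemma matroid_subset: "matroid M \<Longrightarrow> A \<in> M \<Longrightarrow> B \<subseteq> A \<Longrightarrow> B \<in> M"
  unfolding matroid_def by blast

lemma matroid_augment:
  "matroid M \<Longrightarrow> A \<in> M \<Longrightarrow> B \<in> M \<Longrightarrow> card A < card B \<Longrightarrow> \<exists>x\<in>B - A. insert x A \<in> M"
  unfolding matroid_def by blast

lemma card_le_matroid_rank: "A \<in> M \<Longrightarrow> A \<subseteq> S \<Longrightarrow> card A \<le> matroid_rank M S"
  unfolding matroid_rank_def by (rule Max_ge) auto

lemma matroid_rank_attained:
  assumes "{} \<in> M"
  obtains A where "A \<in> M" "A \<subseteq> S" "card A = matroid_rank M S"
proof -
  have "matroid_rank M S \<in> {card A |A. A \<in> M \<and> A \<subseteq> S}"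
    unfolding matroid_rank_def using assms by (intro Max_in) auto
  then show thesis
    using that by force
qed

lemma independent_extend_maximal:
  fixes M :: "'e::finite set set"
  assumes "I \<in> M" "I \<subseteq> S"
  obtains J where "J \<in> M" "I \<subseteq> J" "J \<subseteq> S" "\<And>x. x \<in> S \<Longrightarrow> insert x J \<in> M \<Longrightarrow> x \<in> J"
proof -
  let ?X = "{J. J \<in> M \<and> I \<subseteq> J \<and> J \<subseteq> S}"
  have "finite ?X" "I \<in> ?X"
    using assms by auto
  then obtain J where J: "J \<in> ?X" "\<And>K. K \<in> ?X \<Longrightarrow> J \<subseteq> K \<Longrightarrow> J = K"
    using finite_has_maximal2[of ?X I] by auto
  show thesis
  proof (rule that)
    fix x assume "x \<in> S" "insert x J \<in> M"
    then show "x \<in> J"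
      using J(1) J(2)[of "insert x J"] by auto
  qed (use J(1) in auto)
qed

lemma matroid_bases_iff_card:
  assumes "matroid M"
  shows "B \<in> matroid_bases M \<longleftrightarrow> B \<in> M \<and> card B = matroid_rank M UNIV"
proof
  assume B: "B \<in> matroid_bases M"
  obtain A where A: "A \<in> M" "card A = matroid_rank M UNIV"
    using matroid_rank_attained[of M UNIV] assms unfolding matroid_def by auto
  have "\<not> card B < card A"
  proof
    assume "card B < card A"
    then obtain x where "x \<in> A - B" "insert x B \<in> M"
      using matroid_augment[OF assms, of B A] A B unfolding matroid_bases_def by auto
    then show False
      using B unfolding matroid_bases_def by auto
  qed
  then show "B \<in> M \<and> card B = matroid_rank M UNIV"
    using card_le_matroid_rank[of B M UNIV] A B unfolding matroid_bases_def by auto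
next
  assume B: "B \<in> M \<and> card B = matroid_rank M UNIV"
  have "A = B" if "A \<in> M" "B \<subseteq> A" for A
    using card_le_matroid_rank[of A M UNIV] that B card_subset_eq[of A B] card_mono[of A B]
    by auto
  then show "B \<in> matroid_bases M"
    using B unfolding matroid_bases_def by auto
qed

lemma dependent_contains_circuit:
  fixes M :: "'e::finite set set"
  assumes "A \<notin> M"
  obtains C where "C \<in> circuits M" "C \<subseteq> A"
proof -
  let ?X = "{C. C \<notin> M \<and> C \<subseteq> A}"
  have "finite ?X" "A \<in> ?X"
    using assms by auto
  then obtain C where C: "C \<in> ?X" "\<And>D. D \<in> ?X \<Longrightarrow> D \<subseteq> C \<Longrightarrow> C = D"
    using finite_has_minimal2[of ?X A] by auto
  then have "C \<in> circuits M"
    unfolding circuits_def by blast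
  then show thesis
    using that C by auto
qed

lemma circuit_minus_independent: "C \<in> circuits M \<Longrightarrow> c \<in> C \<Longrightarrow> C - {c} \<in> M"
  unfolding circuits_def by blast

lemma circuit_minus_nonempty:
  assumes "matroid M" "loopless M" "C \<in> circuits M"
  shows "C - {c} \<noteq> {}"
proof
  assume "C - {c} = {}"
  moreover have "{c} \<in> M"
    using assms(2) unfolding loopless_def by simp
  ultimately have "C \<in> M"
    using matroid_subset[OF assms(1), of "{c}" C] by auto
  then show False
    using assms(3) unfolding circuits_def by simp
qed

lemma insert_outside_flat_independent:
  assumes M: "matroid M" and F: "F \<in> flats M" and I: "I \<in> M" "I \<subseteq> F" and x: "x \<notin> F"
  shows "insert x I \<in> M"
proof -
  obtain J where J: "J \<in> M" "I \<subseteq> J" "J \<subseteq> F" "\<And>z. z \<in> F \<Longrightarrow> insert z J \<in> M \<Longrightarrow> z \<in> J"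
    using independent_extend_maximal[OF I] by blast
  obtain K where K: "K \<in> M" "K \<subseteq> insert x F" "card K = matroid_rank M (insert x F)"
    using matroid_rank_attained M unfolding matroid_def by metis
  have "matroid_rank M F < matroid_rank M (insert x F)"
    using F x unfolding flats_def by auto
  then have "card J < card K"
    using card_le_matroid_rank[OF J(1,3)] K(3) by simp
  then obtain z where z: "z \<in> K - J" "insert z J \<in> M"
    using matroid_augment[OF M J(1) K(1)] by blast
  then have "z = x"
    using J(4)[of z] K(2) by auto
  then show ?thesis
    using matroid_subset[OF M z(2), of "insert x I"] J(2) by auto
qed

text \<open>The independent set \<open>I\<close> cannot be enlarged inside \<open>F\<close> and so computes its rank.\<close>

lemma flatI_independent:
  assumes M: "matroid M" and I: "I \<in> M" "I \<subseteq> F"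
    and maximal: "\<And>f. f \<in> F \<Longrightarrow> insert f I \<in> M \<Longrightarrow> f \<in> I"
    and outside: "\<And>e. e \<notin> F \<Longrightarrow> insert e I \<in> M"
  shows "F \<in> flats M"
  unfolding flats_def
proof (intro CollectI allI impI)
  fix e assume e: "e \<notin> F"
  obtain J where J: "J \<in> M" "J \<subseteq> F" "card J = matroid_rank M F"
    using matroid_rank_attained M unfolding matroid_def by metis
  have "\<not> card I < card J"
  proof
    assume "card I < card J"
    then obtain x where "x \<in> J - I" "insert x I \<in> M"
      using matroid_augment[OF M I(1) J(1)] by auto
    then show False
      using maximal[of x] J(2) by auto
  qed
  then have "matroid_rank M F < card (insert e I)"
    using J(3) e I(2) by (subst card_insert_disjoint) auto
  also have "\<dots> \<le> matroid_rank M (insert e F)"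
    using outside[OF e] I(2) by (intro card_le_matroid_rank) auto
  finally show "matroid_rank M F < matroid_rank M (insert e F)" .
qed

lemma matroid_rank_uniform:
  "matroid_rank (uniform_matroid n) S = min (card (S :: 'e::finite set)) n"
proof (rule antisym)
  obtain A where "A \<in> uniform_matroid n" "A \<subseteq> S" "card A = matroid_rank (uniform_matroid n) S"
    using matroid_rank_attained[of "uniform_matroid n" S] unfolding uniform_matroid_def by auto
  then show "matroid_rank (uniform_matroid n) S \<le> min (card S) n"
    using card_mono[of S A] unfolding uniform_matroid_def by auto
  obtain A where "A \<subseteq> S" "card A = min (card S) n"
    using obtain_subset_with_card_n[of "min (card S) n" S] by auto
  then show "min (card S) n \<le> matroid_rank (uniform_matroid n) S"
    using card_le_matroid_rank[of A "uniform_matroid n" S] unfolding uniform_matroid_def by auto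
qed

lemma proper_flat_uniform_iff:
  fixes F :: "'e::finite set"
  assumes "F \<noteq> UNIV"
  shows "F \<in> flats (uniform_matroid n) \<longleftrightarrow> card F < n"
proof -
  have "matroid_rank (uniform_matroid n) F < matroid_rank (uniform_matroid n) (insert e F)
      \<longleftrightarrow> card F < n" if "e \<notin> F" for e
    using that by (auto simp: matroid_rank_uniform)
  then show ?thesis
    using assms unfolding flats_def by auto
qed


section \<open>The number of nbc-bases does not depend on the order\<close>

text \<open>Up to the sign \<open>(-1)\<^sup>k\<close>, this is the value of the Tutte polynomial at \<open>(1, 0)\<close>.\<close>

definition nbc_sign_sum :: "'e::finite set set \<Rightarrow> int" where
  "nbc_sign_sum M = (\<Sum>A | \<exists>B\<in>matroid_bases M. B \<subseteq> A. (-1) ^ card A)"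

text \<open>
  A basis of \<open>A \<union> {c}\<close> that extends \<open>C - {c}\<close> avoids \<open>c\<close>: an element of a circuit is redundant
  for spanning as soon as the rest of the circuit is present.
\<close>

lemma spanning_remove_circuit_element:
  assumes M: "matroid M" and C: "C \<in> circuits M" "c \<in> C" "C - {c} \<subseteq> A"
    and B: "B \<in> matroid_bases M" "B \<subseteq> insert c A"
  shows "\<exists>B'\<in>matroid_bases M. B' \<subseteq> A - {c}"
proof -
  have "C - {c} \<subseteq> A - {c}"
    using C(3) by auto
  then obtain J where J: "J \<in> M" "C - {c} \<subseteq> J" "J \<subseteq> A - {c}"
      "\<And>x. x \<in> A - {c} \<Longrightarrow> insert x J \<in> M \<Longrightarrow> x \<in> J"
    using independent_extend_maximal[OF circuit_minus_independent[OF C(1,2)]] by blast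
  have "\<not> card J < card B"
  proof
    assume "card J < card B"
    then obtain z where z: "z \<in> B - J" "insert z J \<in> M"
      using matroid_augment[OF M J(1)] B(1) unfolding matroid_bases_def by blast
    then have "z = c"
      using J(4)[of z] B(2) by auto
    then have "C \<subseteq> insert z J"
      using J(2) by auto
    then show False
      using matroid_subset[OF M z(2)] C(1) unfolding circuits_def by auto
  qed
  then have "J \<in> matroid_bases M"
    using card_le_matroid_rank[of J M UNIV] J(1) B(1) by (auto simp: matroid_bases_iff_card[OF M])
  then show ?thesis
    using J(3) by blast
qed

lemma linear_order_has_least:
  assumes "linear_order (r :: 'a::finite rel)" "S \<noteq> {}"
  obtains c where "c \<in> S" "\<And>x. x \<in> S \<Longrightarrow> (c, x) \<in> r"
proof -
  have "finite S" by simp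
  then have "S \<noteq> {} \<longrightarrow> (\<exists>c\<in>S. \<forall>x\<in>S. (c, x) \<in> r)"
  proof induction
    case (insert a S)
    have total: "(x, y) \<in> r \<or> (y, x) \<in> r" for x y
      using assms(1) unfolding linear_order_on_def partial_order_on_def preorder_on_def
        refl_on_def total_on_def by (cases "x = y") auto
    have trans: "(x, y) \<in> r \<Longrightarrow> (y, z) \<in> r \<Longrightarrow> (x, z) \<in> r" for x y z
      using assms(1) unfolding linear_order_on_def partial_order_on_def preorder_on_def
      by (meson transE)
    show ?case
    proof (cases "S = {}")
      case False
      then obtain c where c: "c \<in> S" "\<forall>x\<in>S. (c, x) \<in> r"
        using insert by auto
      show ?thesis
        using total[of a c]
      proof
        assume "(a, c) \<in> r"
        then show ?thesis
          using total[of a a] trans[of a c] c by auto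
      qed (use c in auto)
    qed (use total in auto)
  qed simp
  then show thesis
    using that assms(2) by blast
qed

lemma linear_order_converse: "linear_order r \<Longrightarrow> linear_order (r\<inverse>)"
  by simp

text \<open>
  This is Whitney's broken circuit theorem for the constant coefficient of the characteristic polynomial.
  In the alternating sum over all spanning sets, those that contain a broken circuit cancel in
  pairs: toggle the largest element \<open>c\<close> that completes some broken circuit inside the set. Adding
  \<open>c\<close> creates only broken circuits that contain \<open>c\<close>, and these are completed by an element below
  \<open>c\<close>, so the same \<open>c\<close> is selected before and after. The sets that survive contain no broken
  circuit, hence no circuit, and are therefore the nbc-bases.
\<close>

theorem nbc_eq_sign_sum:
  fixes M :: "'e::finite set set"
  assumes M: "matroid M" and r: "linear_order r"
  shows "nbc_sign_sum M = (-1) ^ matroid_rank M UNIV * int (nbc r M)"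
proof -
  define S where "S = {A. \<exists>B\<in>matroid_bases M. B \<subseteq> A}"
  define T where "T A = {c. \<exists>C\<in>circuits M. c \<in> C \<and> (\<forall>x\<in>C. (c, x) \<in> r) \<and> C - {c} \<subseteq> A}" for A
  have antisym: "(x, y) \<in> r \<Longrightarrow> (y, x) \<in> r \<Longrightarrow> x = y" for x y
    using r by (auto simp: linear_order_on_def partial_order_on_def antisym_def)
  define top where "top A = (THE c. c \<in> T A \<and> (\<forall>x\<in>T A. (x, c) \<in> r))" for A
  have top_eq: "top A = c" if "c \<in> T A" "\<And>x. x \<in> T A \<Longrightarrow> (x, c) \<in> r" for A c
    unfolding top_def using that antisym by (intro the_equality) auto
  have top: "top A \<in> T A" "\<And>x. x \<in> T A \<Longrightarrow> (x, top A) \<in> r" if ne: "T A \<noteq> {}" for A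
  proof -
    obtain c where "c \<in> T A" "\<And>x. x \<in> T A \<Longrightarrow> (c, x) \<in> r\<inverse>"
      using linear_order_has_least[OF linear_order_converse[OF r] ne] by blast
    then show "top A \<in> T A" "\<And>x. x \<in> T A \<Longrightarrow> (x, top A) \<in> r"
      using top_eq[of c A] by auto
  qed
  have top_toggle: "top A' = top A \<and> T A' \<noteq> {}"
    if ne: "T A \<noteq> {}" and A': "A' - {top A} = A - {top A}" for A A'
  proof -
    define c where "c = top A"
    obtain C where C: "C \<in> circuits M" "c \<in> C" "\<forall>x\<in>C. (c, x) \<in> r" "C - {c} \<subseteq> A"
      using top(1)[OF ne] unfolding T_def c_def by auto
    have "c \<in> T A'"
      using C A' unfolding T_def c_def by auto
    moreover have "(x, c) \<in> r" if x: "x \<in> T A'" for x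
    proof -
      obtain D where D: "D \<in> circuits M" "x \<in> D" "\<forall>y\<in>D. (x, y) \<in> r" "D - {x} \<subseteq> A'"
        using x unfolding T_def by auto
      show ?thesis
      proof (cases "c \<in> D")
        case False
        then have "x \<in> T A"
          using D A' unfolding T_def c_def by blast
        then show ?thesis
          using top(2)[OF ne] unfolding c_def by auto
      qed (use D in auto)
    qed
    ultimately show ?thesis
      using top_eq[of c A'] unfolding c_def by auto
  qed
  define toggle where "toggle A = (if top A \<in> A then A - {top A} else insert (top A) A)" for A
  have toggle_diff: "toggle A - {top A} = A - {top A}" for A
    unfolding toggle_def by auto
  have toggle_T: "top (toggle A) = top A \<and> T (toggle A) \<noteq> {}" if "T A \<noteq> {}" for A
    using top_toggle[OF that toggle_diff] .
  have toggle_toggle: "toggle (toggle A) = A" if "T A \<noteq> {}" for A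
    using toggle_T[OF that] unfolding toggle_def by (auto split: if_splits)
  have toggle_S: "toggle A \<in> S" if A: "T A \<noteq> {}" "A \<in> S" for A
  proof -
    obtain C where C: "C \<in> circuits M" "top A \<in> C" "C - {top A} \<subseteq> A"
      using top(1)[OF A(1)] unfolding T_def by auto
    obtain B where "B \<in> matroid_bases M" "B \<subseteq> A"
      using A(2) unfolding S_def by auto
    then obtain B' where "B' \<in> matroid_bases M" "B' \<subseteq> A - {top A}"
      using spanning_remove_circuit_element[OF M C, of B] by blast
    then show ?thesis
      unfolding S_def toggle_def by (auto split: if_splits)
  qed
  have sign: "(-1::int) ^ card (toggle A) = - ((-1) ^ card A)" for A
  proof (cases "top A \<in> A")
    case True
    then have "card A = Suc (card (toggle A))"
      using card.remove[of A "top A"] unfolding toggle_def by simp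
    then show ?thesis by simp
  qed (simp add: toggle_def)
  let ?b = "{A \<in> S. T A \<noteq> {}}" and ?n = "{A \<in> S. T A = {}}"
  have "(\<Sum>A\<in>?b. (-1::int) ^ card A) = (\<Sum>A\<in>?b. - ((-1) ^ card A))"
    by (rule sum.reindex_bij_witness[where i = toggle and j = toggle])
      (auto simp: toggle_toggle toggle_S toggle_T sign)
  then have cancel: "(\<Sum>A\<in>?b. (-1::int) ^ card A) = 0"
    by (simp add: sum_negf)
  have broken: "T A = {} \<longleftrightarrow> \<not> (\<exists>D\<in>broken_circuits r M. D \<subseteq> A)" for A
    unfolding T_def broken_circuits_def by blast
  have indep: "A \<in> M" if "T A = {}" for A
  proof (rule ccontr)
    assume "A \<notin> M"
    then obtain C where C: "C \<in> circuits M" "C \<subseteq> A"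
      by (rule dependent_contains_circuit)
    have "C \<noteq> {}"
      using C(1) M unfolding circuits_def matroid_def by auto
    then obtain c where "c \<in> C" "\<And>x. x \<in> C \<Longrightarrow> (c, x) \<in> r"
      using linear_order_has_least[OF r] by blast
    then have "c \<in> T A"
      using C unfolding T_def by auto
    then show False
      using that by simp
  qed
  have survivors: "?n = nbc_bases r M"
  proof
    show "?n \<subseteq> nbc_bases r M"
    proof
      fix A assume A: "A \<in> ?n"
      then obtain B where B: "B \<in> matroid_bases M" "B \<subseteq> A"
        unfolding S_def by auto
      then have "A = B"
        using indep[of A] A unfolding matroid_bases_def by auto
      then show "A \<in> nbc_bases r M"
        using A B broken[of A] unfolding nbc_bases_def by auto
    qed
    show "nbc_bases r M \<subseteq> ?n"
    proof
      fix A assume "A \<in> nbc_bases r M"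
      then show "A \<in> ?n"
        unfolding S_def nbc_bases_def using broken[of A] by auto
    qed
  qed
  have "nbc_sign_sum M = (\<Sum>A\<in>?b \<union> ?n. (-1::int) ^ card A)"
    unfolding nbc_sign_sum_def S_def by (rule sum.cong) auto
  also have "\<dots> = (\<Sum>A\<in>?b. (-1::int) ^ card A) + (\<Sum>A\<in>?n. (-1) ^ card A)"
    by (rule sum.union_disjoint) auto
  also have "\<dots> = (\<Sum>A\<in>nbc_bases r M. (-1) ^ matroid_rank M UNIV)"
    unfolding cancel survivors add_0
    by (rule sum.cong) (auto simp: nbc_bases_def matroid_bases_iff_card[OF M])
  finally show ?thesis
    unfolding nbc_def by simp
qed

corollary nbc_order_independent:
  assumes "matroid M" "linear_order r" "linear_order s"
  shows "nbc r M = nbc s M"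
  using nbc_eq_sign_sum[OF assms(1,2)] nbc_eq_sign_sum[OF assms(1,3)] by simp


section \<open>Cones of chains of sets\<close>

lemma char_vec_nth: "char_vec S $ e = (if e \<in> S then 1 else 0)"
  unfolding char_vec_def by (simp add: axis_def if_distrib sum.delta cong: if_cong)

lemma least_value_exists:
  fixes z :: "real ^ 'e::finite"
  assumes "A \<noteq> {}"
  obtains a where "a \<in> A" "\<And>e. e \<in> A \<Longrightarrow> z $ a \<le> z $ e"
  using arg_min_if_finite(1)[of A "\<lambda>e. z $ e"] arg_min_least[of A _ "\<lambda>e. z $ e"] assms
  by (metis finite)

lemma mem_span_ones_iff: "x \<in> span {char_vec UNIV} \<longleftrightarrow> (\<forall>e f. x $ e = x $ f)"
proof
  assume "\<forall>e f. x $ e = x $ f"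
  then have "x = x $ undefined *\<^sub>R char_vec UNIV"
    by (auto simp: vec_eq_iff char_vec_nth)
  then show "x \<in> span {char_vec UNIV}"
    unfolding span_singleton by blast
qed (auto simp: span_singleton char_vec_nth)

lemma chain_cone_add:
  assumes "x \<in> chain_cone F" "y \<in> chain_cone F"
  shows "x + y \<in> chain_cone F"
proof -
  obtain a b c d where "x = a + b" "y = c + d"
    "a \<in> convex_cone hull (char_vec ` F)" "c \<in> convex_cone hull (char_vec ` F)"
    "b \<in> span {char_vec UNIV}" "d \<in> span {char_vec UNIV}"
    using assms unfolding chain_cone_def by (elim set_plus_elim)
  then have "x + y = (a + c) + (b + d)" "a + c \<in> convex_cone hull (char_vec ` F)"
    "b + d \<in> span {char_vec UNIV}"
    by (auto intro: convex_cone_hull_add span_add)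
  then show ?thesis
    unfolding chain_cone_def by (simp add: set_plus_intro)
qed

lemma chain_cone_scaleR:
  assumes "x \<in> chain_cone F" "0 \<le> c"
  shows "c *\<^sub>R x \<in> chain_cone F"
proof -
  obtain a b where "x = a + b" "a \<in> convex_cone hull (char_vec ` F)" "b \<in> span {char_vec UNIV}"
    using assms(1) unfolding chain_cone_def by (elim set_plus_elim)
  then show ?thesis
    unfolding chain_cone_def
    by (simp add: scaleR_add_right set_plus_intro convex_cone_hull_mul span_scale assms(2))
qed

lemma chain_cone_mono: "F \<subseteq> G \<Longrightarrow> chain_cone F \<subseteq> chain_cone G"
  unfolding chain_cone_def by (intro set_plus_mono2 hull_mono image_mono) auto

lemma constant_mem_chain_cone:
  assumes "\<And>e f. x $ e = x $ f"
  shows "x \<in> chain_cone F"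
proof -
  have "0 + x \<in> chain_cone F"
    unfolding chain_cone_def using assms
    by (intro set_plus_intro convex_cone_hull_contains_0) (auto simp: mem_span_ones_iff)
  then show ?thesis by simp
qed

lemma char_vec_mem_chain_cone:
  assumes "A \<in> F"
  shows "char_vec A \<in> chain_cone F"
proof -
  have "char_vec A + 0 \<in> chain_cone F"
    unfolding chain_cone_def using assms
    by (intro set_plus_intro hull_inc span_zero) auto
  then show ?thesis by simp
qed

lemma chain_cone_separates:
  fixes x :: "real ^ 'e::finite"
  assumes "x \<in> chain_cone F" "x $ e < x $ f"
  shows "\<exists>A\<in>F. f \<in> A \<and> e \<notin> A"
proof -
  define sep where "sep e f \<longleftrightarrow> (\<exists>A\<in>F. f \<in> A \<and> e \<notin> A)" for e f
  define T where "T = {x :: real ^ 'e. \<forall>e f. \<not> sep e f \<longrightarrow> x $ f \<le> x $ e}"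
  obtain a b where x: "x = a + b" "a \<in> convex_cone hull (char_vec ` F)" "b \<in> span {char_vec UNIV}"
    using assms(1) unfolding chain_cone_def by (elim set_plus_elim)
  have b: "b $ e = b $ f"
    using x(3) mem_span_ones_iff by blast
  have "convex_cone hull (char_vec ` F) \<subseteq> T"
  proof (rule hull_minimal)
    show "char_vec ` F \<subseteq> T"
      unfolding T_def sep_def by (auto simp: char_vec_nth)
    show "convex_cone T"
      unfolding convex_cone_iff T_def by (auto intro: add_mono mult_left_mono)
  qed
  moreover have "\<not> a $ f \<le> a $ e"
    using assms(2) b unfolding x(1) by simp
  ultimately have "sep e f"
    using x(2) unfolding T_def by auto
  then show ?thesis
    unfolding sep_def .
qed

text \<open>
  A function that increases only where the chain \<open>F\<close> allows it is peeled off along \<open>F\<close>: outside the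
  largest member \<open>A\<close> it is constant, and lowering its values on \<open>A\<close> until the smallest of
  them meets that constant leaves a function governed by \<open>F - {A}\<close>.
\<close>

lemma mem_chain_coneI:
  fixes x :: "real ^ 'e::finite"
  assumes "subset.chain (- {{}, UNIV}) F"
    and "\<And>e f. x $ e < x $ f \<Longrightarrow> \<exists>A\<in>F. f \<in> A \<and> e \<notin> A"
  shows "x \<in> chain_cone F"
proof -
  have "finite F" by simp
  then show ?thesis
    using assms
  proof (induction F arbitrary: x rule: finite_psubset_induct)
    case (psubset F)
    show ?case
    proof (cases "F = {}")
      case True
      then have "\<not> x $ e < x $ f" for e f
        using psubset.prems(2) by blast
      then show ?thesis
        by (intro constant_mem_chain_cone) (metis linorder_neqE)
    next
      case False
      define A where "A = \<Union>F"
      have A: "A \<in> F"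
        using Union_in_chain[OF _ False psubset.prems(1)] unfolding A_def by simp
      then have "A \<noteq> {}" "A \<noteq> UNIV"
        using psubset.prems(1) unfolding subset_chain_def by auto
      then obtain e0 where e0: "e0 \<notin> A"
        by auto
      define c where "c = x $ e0"
      obtain g where g: "g \<in> A" "\<And>e. e \<in> A \<Longrightarrow> x $ g \<le> x $ e"
        using least_value_exists[OF \<open>A \<noteq> {}\<close>, of x] by blast
      have outside: "x $ e = c" if "e \<notin> A" for e
        using psubset.prems(2)[of e e0] psubset.prems(2)[of e0 e] that e0
        unfolding c_def A_def by (metis UnionI linorder_neqE)
      have inside: "c \<le> x $ e" for e
        using psubset.prems(2)[of e e0] e0 unfolding c_def A_def by force
      define d where "d = x $ g - c"
      define x' where "x' = x - d *\<^sub>R char_vec A"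
      have x'_nth: "x' $ e = (if e \<in> A then x $ e - d else c)" for e
        unfolding x'_def by (simp add: char_vec_nth outside)
      have "x' \<in> chain_cone (F - {A})"
      proof (rule psubset.IH)
        show "F - {A} \<subset> F"
          using A by auto
        show "subset.chain (- {{}, UNIV}) (F - {A})"
          using psubset.prems(1) unfolding subset_chain_def by auto
        fix e f assume less: "x' $ e < x' $ f"
        have lower: "c \<le> x' $ e"
          using g(2) unfolding x'_nth d_def by auto
        then have f: "f \<in> A"
          using less unfolding x'_nth[of f] by (auto split: if_splits)
        show "\<exists>A'\<in>F - {A}. f \<in> A' \<and> e \<notin> A'"
        proof (cases "e \<in> A")
          case True
          then have "x $ e < x $ f"
            using less f unfolding x'_nth by simp
          then show ?thesis
            using psubset.prems(2)[of e f] True by blast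
        next
          case False
          then have "x $ g < x $ f"
            using less f unfolding x'_nth d_def by simp
          then obtain A' where "A' \<in> F" "f \<in> A'" "g \<notin> A'"
            using psubset.prems(2)[of g f] by blast
          then show ?thesis
            using False g(1) unfolding A_def by blast
        qed
      qed
      then have "x' \<in> chain_cone F"
        using chain_cone_mono[of "F - {A}" F] by auto
      moreover have "d *\<^sub>R char_vec A \<in> chain_cone F"
        using inside[of g] by (intro chain_cone_scaleR char_vec_mem_chain_cone A) (simp add: d_def)
      ultimately have "x' + d *\<^sub>R char_vec A \<in> chain_cone F"
        by (rule chain_cone_add)
      then show ?thesis
        unfolding x'_def by simp
    qed
  qed
qed

text \<open>
  These sets form the smallest chain whose cone contains \<open>x\<close>; the trivial sets \<open>{}\<close> and \<open>UNIV\<close> are left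
  out, as in a proper chain of flats.
\<close>

definition superlevel_sets :: "real ^ 'e::finite \<Rightarrow> 'e set set" where
  "superlevel_sets x = {{e. t \<le> x $ e} |t. True} - {{}, UNIV}"

lemma superlevel_sets_separate:
  assumes "x $ e < x $ f"
  shows "\<exists>A\<in>superlevel_sets x. f \<in> A \<and> e \<notin> A"
proof (rule bexI[where x = "{a. x $ f \<le> x $ a}"])
  have "f \<in> {a. x $ f \<le> x $ a}" "e \<notin> {a. x $ f \<le> x $ a}"
    using assms by auto
  then show "f \<in> {a. x $ f \<le> x $ a} \<and> e \<notin> {a. x $ f \<le> x $ a}"
    and "{a. x $ f \<le> x $ a} \<in> superlevel_sets x"
    unfolding superlevel_sets_def by blast+
qed

lemma superlevel_setsE:
  assumes "A \<in> superlevel_sets x"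
  obtains t where "A = {e. t \<le> x $ e}" "A \<noteq> {}" "A \<noteq> UNIV"
  using assms unfolding superlevel_sets_def by blast

lemma chain_superlevel_sets: "subset.chain (- {{}, UNIV}) (superlevel_sets x)"
  unfolding subset_chain_def
proof (intro conjI ballI)
  show "superlevel_sets x \<subseteq> - {{}, UNIV}"
    unfolding superlevel_sets_def by auto
  fix A B assume "A \<in> superlevel_sets x" "B \<in> superlevel_sets x"
  then obtain s t where "A = {e. s \<le> x $ e}" "B = {e. t \<le> x $ e}"
    by (elim superlevel_setsE)
  then show "A \<subseteq> B \<or> B \<subseteq> A"
    using linear[of s t] by auto
qed

lemma superlevel_sets_separate_iff:
  "(\<exists>A\<in>superlevel_sets x. (e \<in> A) \<noteq> (f \<in> A)) \<longleftrightarrow> x $ e \<noteq> x $ f"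
proof
  assume "x $ e \<noteq> x $ f"
  then show "\<exists>A\<in>superlevel_sets x. (e \<in> A) \<noteq> (f \<in> A)"
    using superlevel_sets_separate[of x e f] superlevel_sets_separate[of x f e] by force
qed (auto elim!: superlevel_setsE)

lemma mem_chain_cone_superlevel_iff:
  "z \<in> chain_cone (superlevel_sets x) \<longleftrightarrow> (\<forall>e f. x $ e \<le> x $ f \<longrightarrow> z $ e \<le> z $ f)"
proof
  assume z: "z \<in> chain_cone (superlevel_sets x)"
  have "z $ e \<le> z $ f" if "x $ e \<le> x $ f" for e f
  proof (rule ccontr)
    assume "\<not> z $ e \<le> z $ f"
    then show False
      using chain_cone_separates[OF z, of f e] that by (fastforce elim: superlevel_setsE)
  qed
  then show "\<forall>e f. x $ e \<le> x $ f \<longrightarrow> z $ e \<le> z $ f"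
    by simp
next
  assume mono: "\<forall>e f. x $ e \<le> x $ f \<longrightarrow> z $ e \<le> z $ f"
  show "z \<in> chain_cone (superlevel_sets x)"
  proof (rule mem_chain_coneI[OF chain_superlevel_sets])
    fix e f assume "z $ e < z $ f"
    then have "x $ e < x $ f"
      using mono by (meson not_less)
    then show "\<exists>A\<in>superlevel_sets x. f \<in> A \<and> e \<notin> A"
      by (rule superlevel_sets_separate)
  qed
qed

lemma self_mem_chain_cone_superlevel: "x \<in> chain_cone (superlevel_sets x)"
  by (simp add: mem_chain_cone_superlevel_iff)

lemma chain_cone_le:
  assumes "subset.chain \<A> F" "x \<in> chain_cone F" "A \<in> F" "e \<in> A" "f \<notin> A"
  shows "x $ f \<le> x $ e"
proof (rule ccontr)
  assume "\<not> x $ f \<le> x $ e"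
  then obtain A' where "A' \<in> F" "f \<in> A'" "e \<notin> A'"
    using chain_cone_separates[OF assms(2), of e f] by auto
  then show False
    using assms unfolding subset_chain_def by blast
qed

text \<open>
  A superlevel set \<open>A\<close> is the union, over \<open>f \<in> A\<close>, of the smallest members of \<open>F\<close> that contain
  \<open>f\<close>. These are contained in \<open>A\<close> because \<open>F\<close> separates \<open>f\<close> from every element outside \<open>A\<close>, and
  nonempty unions and intersections of members of a finite chain are members.
\<close>

lemma superlevel_sets_subset_chain:
  fixes x :: "real ^ 'e::finite"
  assumes chain: "subset.chain \<A> F" and x: "x \<in> chain_cone F"
  shows "superlevel_sets x \<subseteq> F"
proof
  fix A assume A: "A \<in> superlevel_sets x"
  then obtain t where t: "A = {e. t \<le> x $ e}" and ne: "A \<noteq> {}" "A \<noteq> UNIV"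
    by (rule superlevel_setsE)
  have sub: "\<exists>A'\<in>F. f \<in> A' \<and> A' \<subseteq> A" if f: "f \<in> A" for f
  proof -
    let ?G = "{A' \<in> F. f \<in> A'}"
    have sep: "\<exists>A'\<in>?G. e \<notin> A'" if "e \<notin> A" for e
      using chain_cone_separates[OF x, of e f] f that unfolding t by force
    moreover have "?G \<noteq> {}"
      using sep ne(2) by auto
    moreover have "subset.chain \<A> ?G"
      using chain unfolding subset_chain_def by auto
    ultimately have "\<Inter>?G \<in> ?G"
      by (intro Inter_in_chain) auto
    moreover have "\<Inter>?G \<subseteq> A"
      using sep by blast
    ultimately show ?thesis
      by blast
  qed
  let ?H = "{A' \<in> F. A' \<subseteq> A}"
  have "?H \<noteq> {}"
    using ne(1) sub by blast
  moreover have "subset.chain \<A> ?H"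
    using chain unfolding subset_chain_def by auto
  ultimately have "\<Union>?H \<in> ?H"
    by (intro Union_in_chain) auto
  moreover have "\<Union>?H = A"
    using sub by blast
  ultimately show "A \<in> F"
    by auto
qed

text \<open>
  A vector that is constant on the level sets of \<open>x\<close> becomes monotone along \<open>x\<close> after adding a
  large multiple of \<open>x\<close>, so it is a difference of two vectors of the cone.
\<close>

lemma level_constant_mem_direction_space:
  fixes z :: "real ^ 'e::finite"
  assumes "\<And>e f. x $ e = x $ f \<Longrightarrow> z $ e = z $ f"
  shows "z \<in> direction_space (chain_cone (superlevel_sets x))"
proof -
  let ?S = "{(z $ e - z $ f) / (x $ f - x $ e) |e f. x $ e < x $ f}"
  have "finite ?S"
    by (rule finite_subset[where B = "(\<lambda>(e, f). (z $ e - z $ f) / (x $ f - x $ e)) ` UNIV"]) auto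
  define N where "N = Max (insert 0 ?S)"
  have N0: "0 \<le> N"
    unfolding N_def using \<open>finite ?S\<close> by (intro Max_ge) auto
  have N: "(z $ e - z $ f) / (x $ f - x $ e) \<le> N" if "x $ e < x $ f" for e f
    unfolding N_def using \<open>finite ?S\<close> that by (intro Max_ge insertI2) blast+
  have "z + N *\<^sub>R x \<in> chain_cone (superlevel_sets x)"
    unfolding mem_chain_cone_superlevel_iff
  proof (intro allI impI)
    fix e f assume le: "x $ e \<le> x $ f"
    show "(z + N *\<^sub>R x) $ e \<le> (z + N *\<^sub>R x) $ f"
    proof (cases "x $ e = x $ f")
      case True
      then show ?thesis
        using assms[OF True] by simp
    next
      case False
      then have less: "x $ e < x $ f"
        using le by simp
      have "z $ e - z $ f \<le> N * (x $ f - x $ e)"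
        using N[OF less] less by (subst (asm) pos_divide_le_eq) simp_all
      then show ?thesis
        by (simp add: algebra_simps)
    qed
  qed
  moreover have "N *\<^sub>R x \<in> chain_cone (superlevel_sets x)"
    by (intro chain_cone_scaleR self_mem_chain_cone_superlevel N0)
  ultimately have "(z + N *\<^sub>R x) - N *\<^sub>R x \<in> direction_space (chain_cone (superlevel_sets x))"
    unfolding direction_space_def by (intro span_base) blast
  then show ?thesis
    by simp
qed


section \<open>Chains of flats whose reflected cone sums span the space\<close>

lemma proper_flat_chain_subset_chain:
  "proper_flat_chain M F \<Longrightarrow> subset.chain (- {{}, UNIV}) F"
  unfolding proper_flat_chain_def subset_chain_def by auto

lemma proper_flat_chain_flats: "proper_flat_chain M F \<Longrightarrow> A \<in> F \<Longrightarrow> A \<in> flats M"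
  unfolding proper_flat_chain_def subset_chain_def by auto

lemma proper_flat_chain_mono: "proper_flat_chain M F \<Longrightarrow> G \<subseteq> F \<Longrightarrow> proper_flat_chain M G"
  unfolding proper_flat_chain_def subset_chain_def by (meson subset_eq)

lemma proper_flat_chain_superlevel_iff:
  "proper_flat_chain M (superlevel_sets x) \<longleftrightarrow> superlevel_sets x \<subseteq> flats M"
  using chain_superlevel_sets[of x] unfolding proper_flat_chain_def subset_chain_def by auto

text \<open>
  The largest member of the chain that misses some element of \<open>X\<close> contains all the other elements,
  because each of these is separated from the missing one. As it is a flat, the missing element can
  be added to the others without creating a dependency.
\<close>

lemma separated_independent:
  fixes M :: "'e::finite set set"
  assumes M: "matroid M" "loopless M" and F: "proper_flat_chain M F"
    and "\<And>e f. e \<in> X \<Longrightarrow> f \<in> X \<Longrightarrow> e \<noteq> f \<Longrightarrow> \<exists>A\<in>F. (e \<in> A) \<noteq> (f \<in> A)"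
  shows "X \<in> M"
proof -
  have "finite X" by simp
  then show ?thesis
    using assms(4)
  proof (induction X rule: finite_psubset_induct)
    case (psubset X)
    show ?case
    proof (cases "\<exists>a. X \<subseteq> {a}")
      case True
      then obtain a where "X \<subseteq> {a}" ..
      moreover have "{a} \<in> M"
        using M(2) unfolding loopless_def by simp
      ultimately show ?thesis
        using matroid_subset[OF M(1)] by blast
    next
      case False
      then obtain a b where ab: "a \<in> X" "b \<in> X" "a \<noteq> b"
        by blast
      let ?G = "{A \<in> F. \<not> X \<subseteq> A}"
      obtain A0 where "A0 \<in> F" "(a \<in> A0) \<noteq> (b \<in> A0)"
        using psubset.prems[OF ab] by blast
      then have "A0 \<in> ?G"
        using ab by auto
      then have ne: "?G \<noteq> {}"
        by auto
      have "subset.chain (- {{}, UNIV}) ?G"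
        using proper_flat_chain_subset_chain[OF F] unfolding subset_chain_def by auto
      then have G: "\<Union>?G \<in> ?G"
        using ne by (intro Union_in_chain) auto
      then obtain x where x: "x \<in> X" "x \<notin> \<Union>?G"
        by blast
      have sub: "X - {x} \<subseteq> \<Union>?G"
      proof
        fix z assume z: "z \<in> X - {x}"
        then obtain A where "A \<in> F" "(x \<in> A) \<noteq> (z \<in> A)"
          using psubset.prems[of x z] x(1) by blast
        then show "z \<in> \<Union>?G"
          using x z by blast
      qed
      have "X - {x} \<in> M"
        using x(1) by (intro psubset.IH psubset.prems) auto
      then have "insert x (X - {x}) \<in> M"
        using insert_outside_flat_independent[OF M(1) _ _ sub x(2)]
          proper_flat_chain_flats[OF F, of "\<Union>?G"] G by blast
      then show ?thesis
        using x(1) by (simp add: insert_absorb)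
    qed
  qed
qed

lemma chain_cone_unseparated:
  assumes "x \<in> chain_cone F" "\<not> (\<exists>A\<in>F. (e \<in> A) \<noteq> (f \<in> A))"
  shows "x $ e = x $ f"
  using chain_cone_separates[OF assms(1), of e f] chain_cone_separates[OF assms(1), of f e] assms(2)
  by (meson linorder_neqE)

text \<open>
  The cells \<open>-\<sigma>\<^sub>F\<close> and \<open>\<sigma>\<^sub>G\<close> together span the space, which is the condition for the pair to
  contribute to the stable intersection. It is applied by exhibiting a subspace that contains both.
\<close>

definition transversal_pair :: "'e::finite set set \<Rightarrow> 'e set set \<Rightarrow> bool" where
  "transversal_pair F G \<longleftrightarrow> aff_dim (uminus ` chain_cone F + chain_cone G) = int CARD('e)"

lemma transversal_pair_subspace:
  fixes F G :: "'e::finite set set"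
  assumes "transversal_pair F G" "subspace T"
    and "\<And>x y. x \<in> chain_cone F \<Longrightarrow> y \<in> chain_cone G \<Longrightarrow> y - x \<in> T"
  shows "z \<in> T"
proof -
  have "uminus ` chain_cone F + chain_cone G \<subseteq> T"
    using assms(3) by (auto elim!: set_plus_elim)
  then have "affine hull (uminus ` chain_cone F + chain_cone G) \<subseteq> T"
    using subspace_imp_affine[OF assms(2)] by (rule hull_minimal)
  moreover have "affine hull (uminus ` chain_cone F + chain_cone G) = UNIV"
    using assms(1) aff_dim_eq_full[of "uminus ` chain_cone F + chain_cone G"]
    unfolding transversal_pair_def by simp
  ultimately show ?thesis
    by auto
qed

lemma transversal_pair_separates:
  fixes F G :: "'e::finite set set"
  assumes T: "transversal_pair F G" and "e \<noteq> f"
  shows "(\<exists>A\<in>F. (e \<in> A) \<noteq> (f \<in> A)) \<or> (\<exists>A\<in>G. (e \<in> A) \<noteq> (f \<in> A))"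
proof (rule ccontr)
  assume not: "\<not> ?thesis"
  let ?T = "{z :: real ^ 'e. z $ e = z $ f}"
  have "axis e 1 \<in> ?T"
  proof (rule transversal_pair_subspace[OF T])
    show "subspace ?T"
      by (auto simp: subspace_def)
    fix x y assume "x \<in> chain_cone F" "y \<in> chain_cone G"
    then show "y - x \<in> ?T"
      using not chain_cone_unseparated[of x F e f] chain_cone_unseparated[of y G e f] by simp
  qed
  then show False
    using assms(2) by (simp add: axis_def)
qed

text \<open>
  Call two elements equivalent for a chain if no member of it separates them. Since the members
  of \<open>G\<close> have at most \<open>m - k\<close> elements, the complement \<open>B\<close> of their union has at least \<open>k\<close> elements,
  and all of them are equivalent for \<open>G\<close>. As the cones span the space, \<open>F\<close> must separate the elements
  of \<open>B\<close>, so they are independent and \<open>B\<close> is a basis. It has exactly one element in each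
  equivalence class of \<open>F\<close>, since a further class would give \<open>k + 1\<close> independent elements. Finally,
  if \<open>e\<close> and \<open>f\<close> outside \<open>B\<close> were equivalent for \<open>G\<close>, and \<open>b\<close>, \<open>c\<close> are the elements of \<open>B\<close> that
  represent them for \<open>F\<close>, then the functional \<open>z\<^sub>e - z\<^sub>b - z\<^sub>f + z\<^sub>c\<close> would vanish on both cones.
\<close>

lemma transversal_pair_structure:
  fixes M :: "'e::finite set set" and F G
  assumes M: "matroid M" "loopless M" and F: "proper_flat_chain M F"
    and G: "proper_flat_chain (uniform_matroid (CARD('e) - matroid_rank M UNIV + 1)) G"
    and T: "transversal_pair F G"
  defines "B \<equiv> - \<Union>G"
  shows transversal_basis: "B \<in> matroid_bases M"
    and transversal_basis_separated:
      "\<And>b c. b \<in> B \<Longrightarrow> c \<in> B \<Longrightarrow> b \<noteq> c \<Longrightarrow> \<exists>A\<in>F. (b \<in> A) \<noteq> (c \<in> A)"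
    and transversal_basis_represents: "\<And>e. \<exists>b\<in>B. \<forall>A\<in>F. e \<in> A \<longleftrightarrow> b \<in> A"
    and transversal_cobasis_separated:
      "\<And>e f. e \<notin> B \<Longrightarrow> f \<notin> B \<Longrightarrow> e \<noteq> f \<Longrightarrow> \<exists>A\<in>G. (e \<in> A) \<noteq> (f \<in> A)"
proof -
  let ?k = "matroid_rank M UNIV"
  show sep: "\<exists>A\<in>F. (b \<in> A) \<noteq> (c \<in> A)" if "b \<in> B" "c \<in> B" "b \<noteq> c" for b c
    using transversal_pair_separates[OF T that(3)] that unfolding B_def by auto
  have B: "B \<in> M"
    by (rule separated_independent[OF M F sep])
  have "card (\<Union>G) \<le> CARD('e) - ?k"
  proof (cases "G = {}")
    case False
    then have "\<Union>G \<in> G"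
      using proper_flat_chain_subset_chain[OF G] by (intro Union_in_chain) auto
    then have "\<Union>G \<noteq> UNIV" "\<Union>G \<in> flats (uniform_matroid (CARD('e) - ?k + 1))"
      using G unfolding proper_flat_chain_def subset_chain_def by auto
    then show ?thesis
      using proper_flat_uniform_iff[of "\<Union>G"] by simp
  qed simp
  moreover obtain I where "I \<in> M" "card I = ?k"
    using matroid_rank_attained[of M UNIV] M(1) unfolding matroid_def by auto
  then have "?k \<le> CARD('e)"
    by (metis card_mono finite subset_UNIV)
  ultimately have "?k \<le> card B"
    unfolding B_def by (simp add: Compl_eq_Diff_UNIV card_Diff_subset)
  then have card: "card B = ?k"
    using card_le_matroid_rank[OF B, of UNIV] by simp
  then show "B \<in> matroid_bases M"
    using B matroid_bases_iff_card[OF M(1)] by simp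
  show represents: "\<exists>b\<in>B. \<forall>A\<in>F. e \<in> A \<longleftrightarrow> b \<in> A" for e
  proof (rule ccontr)
    assume not: "\<not> ?thesis"
    then have "e \<notin> B"
      by auto
    have "\<exists>A\<in>F. (b \<in> A) \<noteq> (c \<in> A)" if bc: "b \<in> insert e B" "c \<in> insert e B" "b \<noteq> c" for b c
    proof -
      have new: "\<exists>A\<in>F. (e \<in> A) \<noteq> (d \<in> A)" if "d \<in> B" for d
        using not that by auto
      consider "b \<in> B" "c \<in> B" | "b = e" "c \<in> B" | "b \<in> B" "c = e"
        using bc by auto
      then show ?thesis
      proof cases
        case 1
        then show ?thesis
          using sep bc(3) by simp
      next
        case 2
        then show ?thesis
          using new[of c] by simp
      next
        case 3
        then obtain A where "A \<in> F" "(e \<in> A) \<noteq> (b \<in> A)"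
          using new[of b] by auto
        then show ?thesis
          using 3 by auto
      qed
    qed
    then have "insert e B \<in> M"
      by (rule separated_independent[OF M F])
    then have "card (insert e B) \<le> ?k"
      by (rule card_le_matroid_rank) simp
    then show False
      using card \<open>e \<notin> B\<close> by simp
  qed
  show "\<exists>A\<in>G. (e \<in> A) \<noteq> (f \<in> A)" if ef: "e \<notin> B" "f \<notin> B" "e \<noteq> f" for e f
  proof (rule ccontr)
    assume not: "\<not> ?thesis"
    obtain b c where b: "b \<in> B" "\<forall>A\<in>F. e \<in> A \<longleftrightarrow> b \<in> A" and c: "c \<in> B" "\<forall>A\<in>F. f \<in> A \<longleftrightarrow> c \<in> A"
      using represents[of e] represents[of f] by auto
    let ?T = "{z :: real ^ 'e. z $ e - z $ b = z $ f - z $ c}"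
    have "axis e 1 \<in> ?T"
    proof (rule transversal_pair_subspace[OF T])
      show "subspace ?T"
        unfolding subspace_def
      proof (intro conjI ballI allI)
        fix u v and r :: real assume "u \<in> ?T" "v \<in> ?T"
        then show "u + v \<in> ?T"
          by simp
        have "r * (u $ e - u $ b) = r * (u $ f - u $ c)"
          using \<open>u \<in> ?T\<close> by simp
        then show "r *\<^sub>R u \<in> ?T"
          by (simp add: right_diff_distrib)
      qed simp
      fix x y assume x: "x \<in> chain_cone F" and y: "y \<in> chain_cone G"
      have "x $ e = x $ b" "x $ f = x $ c"
        by (rule chain_cone_unseparated[OF x]; use b c in auto)+
      moreover have "y $ e = y $ f"
        using chain_cone_unseparated[OF y not] .
      moreover have "y $ b = y $ c"
        by (rule chain_cone_unseparated[OF y]) (use b(1) c(1) in \<open>auto simp: B_def\<close>)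
      ultimately show "y - x \<in> ?T"
        by simp
    qed
    moreover have "b \<noteq> e" "c \<noteq> e"
      using b(1) c(1) ef by auto
    ultimately show False
      using ef by (simp add: axis_def)
  qed
qed


section \<open>Decompositions of a generic vector\<close>

text \<open>The genericity of the displacement \<open>-w\<close>, seen as a condition on the ways to write \<open>w\<close> as a sum.\<close>

definition generic_sum :: "'e::finite set set \<Rightarrow> real ^ 'e \<Rightarrow> bool" where
  "generic_sum M w \<longleftrightarrow>
     (\<forall>F G. \<forall>x\<in>chain_cone F. \<forall>y\<in>chain_cone G. proper_flat_chain M F \<longrightarrow>
        proper_flat_chain (uniform_matroid (CARD('e) - matroid_rank M UNIV + 1)) G \<longrightarrow>
        x + y = w \<longrightarrow> transversal_pair F G)"

lemma generic_sumD:
  fixes M :: "'e::finite set set"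
  assumes "generic_sum M w" "proper_flat_chain M F"
    "proper_flat_chain (uniform_matroid (CARD('e) - matroid_rank M UNIV + 1)) G"
    "x \<in> chain_cone F" "y \<in> chain_cone G" "x + y = w"
  shows "transversal_pair F G"
  using assms unfolding generic_sum_def by blast

text \<open>
  The superlevel sets of \<open>x\<close> and \<open>y\<close> form subchains of \<open>F\<close> and \<open>G\<close> whose cones still contain \<open>x\<close>
  and \<open>y\<close>, so genericity gives them the structure described above as well. Both pairs of chains
  then have the same basis, and comparing the values of \<open>x\<close> on this basis and of \<open>y\<close> off it
  shows that no member of \<open>F\<close> or \<open>G\<close> is lost. In particular, a pair of cones whose sum contains a
  generic vector cannot be enlarged.
\<close>

lemma generic_sum_determines_chains:
  fixes M :: "'e::finite set set"
  assumes M: "matroid M" "loopless M" and w: "generic_sum M w"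
    and F: "proper_flat_chain M F"
    and G: "proper_flat_chain (uniform_matroid (CARD('e) - matroid_rank M UNIV + 1)) G"
    and x: "x \<in> chain_cone F" and y: "y \<in> chain_cone G" and sum: "x + y = w"
  shows "F = superlevel_sets x" and "G = superlevel_sets y"
proof -
  note chainF = proper_flat_chain_subset_chain[OF F]
  note chainG = proper_flat_chain_subset_chain[OF G]
  have subF: "superlevel_sets x \<subseteq> F"
    by (rule superlevel_sets_subset_chain[OF chainF x])
  have subG: "superlevel_sets y \<subseteq> G"
    by (rule superlevel_sets_subset_chain[OF chainG y])
  note F' = proper_flat_chain_mono[OF F subF]
  note G' = proper_flat_chain_mono[OF G subG]
  note T = generic_sumD[OF w F G x y sum]
  note T' = generic_sumD[OF w F' G' self_mem_chain_cone_superlevel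
      self_mem_chain_cone_superlevel sum]
  define B where "B = - \<Union>G"
  have "B \<subseteq> - \<Union>(superlevel_sets y)"
    unfolding B_def using subG by blast
  then have B_eq: "- \<Union>(superlevel_sets y) = B"
    using transversal_basis[OF M F' G' T'] transversal_basis[OF M F G T]
    unfolding B_def[symmetric] matroid_bases_def by blast
  have inj: "x $ b \<noteq> x $ c" if "b \<in> B" "c \<in> B" "b \<noteq> c" for b c
    using transversal_basis_separated[OF M F' G' T', of b c] that
    unfolding B_eq superlevel_sets_separate_iff by blast
  have inj': "y $ e \<noteq> y $ f" if "e \<notin> B" "f \<notin> B" "e \<noteq> f" for e f
    using transversal_cobasis_separated[OF M F' G' T', of e f] that
    unfolding B_eq superlevel_sets_separate_iff by blast
  have "A \<in> superlevel_sets x" if A: "A \<in> F" for A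
  proof -
    have ne: "A \<noteq> {}" "A \<noteq> UNIV"
      using chainF A unfolding subset_chain_def by auto
    obtain a where a: "a \<in> A" "\<And>e. e \<in> A \<Longrightarrow> x $ a \<le> x $ e"
      using least_value_exists[OF ne(1)] by blast
    have "e \<in> A" if e: "x $ a \<le> x $ e" for e
    proof (rule ccontr)
      assume "e \<notin> A"
      obtain b c where b: "b \<in> B" "\<forall>A\<in>F. e \<in> A \<longleftrightarrow> b \<in> A"
        and c: "c \<in> B" "\<forall>A\<in>F. a \<in> A \<longleftrightarrow> c \<in> A"
        using transversal_basis_represents[OF M F G T, of e]
          transversal_basis_represents[OF M F G T, of a] unfolding B_def by auto
      have "x $ e = x $ a"
        using chain_cone_le[OF chainF x A a(1) \<open>e \<notin> A\<close>] e by simp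
      moreover have "x $ e = x $ b" "x $ a = x $ c"
        by (rule chain_cone_unseparated[OF x]; use b c in auto)+
      moreover have "b \<noteq> c"
        using A a(1) \<open>e \<notin> A\<close> b c by auto
      ultimately show False
        using inj[OF b(1) c(1)] by simp
    qed
    then have "A = {e. x $ a \<le> x $ e}"
      using a(2) by auto
    then show ?thesis
      using ne unfolding superlevel_sets_def by blast
  qed
  then show "F = superlevel_sets x"
    using subF by blast
  have "A \<in> superlevel_sets y" if A: "A \<in> G" for A
  proof -
    have ne: "A \<noteq> {}" "A \<noteq> UNIV"
      using chainG A unfolding subset_chain_def by auto
    obtain a where a: "a \<in> A" "\<And>e. e \<in> A \<Longrightarrow> y $ a \<le> y $ e"
      using least_value_exists[OF ne(1)] by blast
    have "a \<notin> B"
      using a(1) A unfolding B_def by blast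
    have "e \<in> A" if e: "y $ a \<le> y $ e" for e
    proof (rule ccontr)
      assume "e \<notin> A"
      have eq: "y $ e = y $ a"
        using chain_cone_le[OF chainG y A a(1) \<open>e \<notin> A\<close>] e by simp
      then have "e \<in> \<Union>(superlevel_sets y) \<longleftrightarrow> a \<in> \<Union>(superlevel_sets y)"
        using superlevel_sets_separate_iff[of y e a] by blast
      then have "e \<notin> B"
        using \<open>a \<notin> B\<close> B_eq by blast
      then show False
        using inj'[OF _ \<open>a \<notin> B\<close>] eq \<open>e \<notin> A\<close> a(1) by blast
    qed
    then have "A = {e. y $ a \<le> y $ e}"
      using a(2) by auto
    then show ?thesis
      using ne unfolding superlevel_sets_def by blast
  qed
  then show "G = superlevel_sets y"
    using subG by blast
qed


section \<open>Decompositions correspond to nbc-bases\<close>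

text \<open>
  The pairs \<open>x + y = w\<close> with \<open>x\<close> and \<open>y\<close> in the supports of the Bergman fans of \<open>M\<close> and of
  \<open>U\<^sub>m\<^sub>,\<^sub>m\<^sub>-\<^sub>k\<^sub>+\<^sub>1\<close>. Both supports are invariant under adding constants, so \<open>min y = 0\<close> is a
  normalization.
\<close>

definition decompositions :: "'e::finite set set \<Rightarrow> real ^ 'e \<Rightarrow> ((real ^ 'e) \<times> (real ^ 'e)) set" where
  "decompositions M w = {(x, y). x + y = w \<and> superlevel_sets x \<subseteq> flats M \<and>
     superlevel_sets y \<subseteq> flats (uniform_matroid (CARD('e) - matroid_rank M UNIV + 1)) \<and>
     (\<forall>e. 0 \<le> y $ e) \<and> (\<exists>e. y $ e = 0)}"

definition zero_set :: "real ^ 'e \<Rightarrow> 'e set" where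
  "zero_set y = {e. y $ e = 0}"

lemma minima_eq_Compl_superlevel: "- \<Union>(superlevel_sets y) = {e. \<forall>f. y $ e \<le> y $ f}"
proof (intro set_eqI iffI)
  fix e assume e: "e \<in> - \<Union>(superlevel_sets y)"
  have "y $ e \<le> y $ f" for f
    using superlevel_sets_separate[of y f e] e by fastforce
  then show "e \<in> {e. \<forall>f. y $ e \<le> y $ f}"
    by simp
next
  fix e assume e: "e \<in> {e. \<forall>f. y $ e \<le> y $ f}"
  have "e \<notin> A" if A: "A \<in> superlevel_sets y" for A
  proof
    assume "e \<in> A"
    obtain t where t: "A = {e. t \<le> y $ e}" "A \<noteq> UNIV"
      using A by (rule superlevel_setsE)
    then have "A = UNIV"
      using \<open>e \<in> A\<close> e by (auto intro: order_trans)
    then show False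
      using t by simp
  qed
  then show "e \<in> - \<Union>(superlevel_sets y)"
    by auto
qed

lemma decompositions_zero_set:
  assumes "(x, y) \<in> decompositions M w"
  shows "zero_set y = - \<Union>(superlevel_sets y)"
proof -
  obtain z where "y $ z = 0" "\<And>e. 0 \<le> y $ e"
    using assms unfolding decompositions_def by auto
  then show ?thesis
    unfolding minima_eq_Compl_superlevel zero_set_def by (auto intro: antisym) (metis antisym)
qed

lemma decompositions_chains:
  fixes M :: "'e::finite set set"
  assumes "(x, y) \<in> decompositions M w"
  shows "proper_flat_chain M (superlevel_sets x)"
    and "proper_flat_chain (uniform_matroid (CARD('e) - matroid_rank M UNIV + 1)) (superlevel_sets y)"
    and "x + y = w"
  using assms unfolding decompositions_def proper_flat_chain_superlevel_iff by auto

lemma decompositions_transversal: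
  assumes "generic_sum M w" "(x, y) \<in> decompositions M w"
  shows "transversal_pair (superlevel_sets x) (superlevel_sets y)"
  using generic_sumD[OF assms(1) decompositions_chains(1,2)[OF assms(2)]
      self_mem_chain_cone_superlevel self_mem_chain_cone_superlevel
      decompositions_chains(3)[OF assms(2)]] .

lemma decompositions_basis:
  assumes M: "matroid M" "loopless M" and w: "generic_sum M w"
    and xy: "(x, y) \<in> decompositions M w"
  shows "zero_set y \<in> matroid_bases M"
    and "\<And>b c. b \<in> zero_set y \<Longrightarrow> c \<in> zero_set y \<Longrightarrow> x $ b = x $ c \<Longrightarrow> b = c"
    and "\<And>e f. e \<notin> zero_set y \<Longrightarrow> f \<notin> zero_set y \<Longrightarrow> y $ e = y $ f \<Longrightarrow> e = f"
    and "\<And>e. \<exists>b\<in>zero_set y. x $ e = x $ b"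
proof -
  note C = decompositions_chains[OF xy] decompositions_transversal[OF w xy]
  note props = transversal_pair_structure[OF M C(1,2,4)]
  show "zero_set y \<in> matroid_bases M"
    using props(1) unfolding decompositions_zero_set[OF xy] .
  show "b = c" if "b \<in> zero_set y" "c \<in> zero_set y" "x $ b = x $ c" for b c
    using props(2)[of b c] that
    unfolding superlevel_sets_separate_iff decompositions_zero_set[OF xy] by auto
  show "e = f" if "e \<notin> zero_set y" "f \<notin> zero_set y" "y $ e = y $ f" for e f
    using props(4)[of e f] that
    unfolding superlevel_sets_separate_iff decompositions_zero_set[OF xy] by auto
  show "\<exists>b\<in>zero_set y. x $ e = x $ b" for e
  proof -
    obtain b where b: "b \<in> zero_set y" "\<forall>A\<in>superlevel_sets x. e \<in> A \<longleftrightarrow> b \<in> A"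
      using props(3)[of e] unfolding decompositions_zero_set[OF xy] by auto
    then have "x $ e = x $ b"
      using superlevel_sets_separate_iff[of x e b] by simp
    then show ?thesis
      using b(1) by auto
  qed
qed

text \<open>
  This is the description of the Bergman fan by circuits: on a circuit, the minimum of \<open>x\<close> is
  attained at least twice. Otherwise some superlevel set of \<open>x\<close> would contain the whole circuit
  except for its minimal element, and would not be a flat.
\<close>

lemma circuit_minimum_twice:
  fixes M :: "'e::finite set set"
  assumes M: "matroid M" "loopless M" and x: "superlevel_sets x \<subseteq> flats M"
    and C: "C \<in> circuits M" "c \<in> C"
  shows "\<exists>d\<in>C - {c}. x $ d \<le> x $ c"
proof (rule ccontr)
  assume not: "\<not> ?thesis"
  obtain a where a: "a \<in> C - {c}" "\<And>d. d \<in> C - {c} \<Longrightarrow> x $ a \<le> x $ d"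
    using least_value_exists[OF circuit_minus_nonempty[OF M C(1)], where z = x] by blast
  let ?A = "{e. x $ a \<le> x $ e}"
  have c: "c \<notin> ?A"
    using not a(1) by auto
  have sub: "C - {c} \<subseteq> ?A"
    using a(2) by auto
  have "a \<in> ?A"
    by simp
  then have "?A \<in> superlevel_sets x"
    using c unfolding superlevel_sets_def by blast
  then have "insert c (C - {c}) \<in> M"
    using insert_outside_flat_independent[OF M(1) _ circuit_minus_independent[OF C] sub c] x by blast
  then show False
    using C unfolding circuits_def by (simp add: insert_absorb)
qed

text \<open>A generic vector may have repeated entries, so ties are broken by \<open>r\<close>.\<close>

definition value_order :: "real ^ 'e \<Rightarrow> 'e rel \<Rightarrow> 'e rel" where
  "value_order w r = {(a, b). w $ a < w $ b \<or> w $ a = w $ b \<and> (a, b) \<in> r}"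

lemma linear_order_value_order:
  assumes "linear_order r"
  shows "linear_order (value_order w r)"
proof -
  have r: "refl r" "trans r" "antisym r" "total r"
    using assms by (auto simp: linear_order_on_def partial_order_on_def preorder_on_def)
  have "refl (value_order w r)"
    using r(1) unfolding refl_on_def value_order_def by auto
  moreover have "trans (value_order w r)"
    using r(2) unfolding trans_def value_order_def by auto
  moreover have "antisym (value_order w r)"
    using r(3) unfolding antisym_def value_order_def by auto
  moreover have "total (value_order w r)"
    using r(4) unfolding total_on_def value_order_def by auto
  ultimately show ?thesis
    by (simp add: linear_order_on_def partial_order_on_def preorder_on_def)
qed

text \<open>
  If \<open>C - {c}\<close> lies in the zero set of \<open>y\<close> and \<open>c\<close> is the smallest element of the circuit \<open>C\<close>, then
  \<open>x\<^sub>c < w\<^sub>c \<le> w\<^sub>d = x\<^sub>d\<close> for all other \<open>d \<in> C\<close>, so \<open>x\<close> attains its minimum on \<open>C\<close> only once.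
\<close>

lemma zero_set_nbc:
  assumes M: "matroid M" "loopless M" and w: "generic_sum M w"
    and xy: "(x, y) \<in> decompositions M w"
  shows "zero_set y \<in> nbc_bases (value_order w r) M"
proof -
  have sum: "w $ e = x $ e + y $ e" and nonneg: "0 \<le> y $ e" for e
    using xy unfolding decompositions_def by auto
  have x: "superlevel_sets x \<subseteq> flats M"
    using xy unfolding decompositions_def by auto
  note B = decompositions_basis(1)[OF M w xy]
  have "\<not> D \<subseteq> zero_set y" if D: "D \<in> broken_circuits (value_order w r) M" for D
  proof
    assume sub: "D \<subseteq> zero_set y"
    obtain C c where C: "C \<in> circuits M" "c \<in> C" "D = C - {c}"
      and least: "\<And>d. d \<in> C \<Longrightarrow> (c, d) \<in> value_order w r"
      using D unfolding broken_circuits_def by auto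
    have "\<not> C \<subseteq> zero_set y"
      using matroid_subset[OF M(1), of "zero_set y" C] B C(1)
      unfolding matroid_bases_def circuits_def by auto
    then have "y $ c \<noteq> 0"
      using sub C(3) unfolding zero_set_def by auto
    moreover obtain d where d: "d \<in> C - {c}" "x $ d \<le> x $ c"
      using circuit_minimum_twice[OF M x C(1,2)] by auto
    moreover have "y $ d = 0"
      using d(1) sub C(3) unfolding zero_set_def by auto
    moreover have "w $ c \<le> w $ d"
      using least[of d] d(1) unfolding value_order_def by auto
    ultimately show False
      using sum[of c] sum[of d] nonneg[of c] by linarith
  qed
  then show ?thesis
    using B unfolding nbc_bases_def by auto
qed

text \<open>
  Off the basis \<open>B = zero_set y\<close>, the circuit description determines \<open>x\<close>: as \<open>x\<close> equals \<open>w\<close> on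
  \<open>B\<close> and is injective there, the repeated minimum over the fundamental circuit of \<open>e\<close> must be attained
  at \<open>e\<close> itself.
\<close>

lemma decomposition_value_fundamental_circuit:
  assumes M: "matroid M" "loopless M" and w: "generic_sum M w"
    and xy: "(x, y) \<in> decompositions M w"
    and C: "C \<in> circuits M" "e \<in> C" "C - {e} \<subseteq> zero_set y"
    and a: "a \<in> C - {e}" "\<And>d. d \<in> C - {e} \<Longrightarrow> w $ a \<le> w $ d"
  shows "x $ e = w $ a"
proof (rule antisym)
  have x_eq: "x $ d = w $ d" if "d \<in> C - {e}" for d
    using xy that C(3) unfolding decompositions_def zero_set_def by auto
  have x: "superlevel_sets x \<subseteq> flats M"
    using xy unfolding decompositions_def by auto
  obtain d where d: "d \<in> C - {a}" "x $ d \<le> x $ a"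
    using circuit_minimum_twice[OF M x C(1)] a(1) by blast
  show "x $ e \<le> w $ a"
  proof (cases "d = e")
    case True
    then show ?thesis
      using d x_eq[OF a(1)] by simp
  next
    case False
    then have "x $ d = x $ a"
      using d x_eq[of d] x_eq[OF a(1)] a(2)[of d] by simp
    then have "d = a"
      using decompositions_basis(2)[OF M w xy, of d a] C(3) d(1) a(1) False by blast
    then show ?thesis
      using d(1) by simp
  qed
  obtain d where d: "d \<in> C - {e}" "x $ d \<le> x $ e"
    using circuit_minimum_twice[OF M x C(1,2)] by blast
  then show "w $ a \<le> x $ e"
    using a(2)[OF d(1)] x_eq[OF d(1)] by simp
qed

lemma zero_set_inj_on_decompositions:
  assumes M: "matroid M" "loopless M" and w: "generic_sum M w"
  shows "inj_on (\<lambda>(x, y). zero_set y) (decompositions M w)"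
proof (rule inj_onI, clarify)
  fix x y x' y' assume xy: "(x, y) \<in> decompositions M w" "(x', y') \<in> decompositions M w"
    and eq: "zero_set y = zero_set y'"
  have sum: "x + y = w" "x' + y' = w"
    using xy unfolding decompositions_def by auto
  have "x $ e = x' $ e" for e
  proof (cases "e \<in> zero_set y")
    case True
    then have "y $ e = 0" "y' $ e = 0"
      using eq unfolding zero_set_def by auto
    then show ?thesis
      using sum by (metis add.right_neutral vector_add_component)
  next
    case False
    note B = decompositions_basis(1)[OF M w xy(1)]
    have "insert e (zero_set y) \<notin> M"
      using B False unfolding matroid_bases_def by blast
    then obtain C where C: "C \<in> circuits M" "C \<subseteq> insert e (zero_set y)"
      by (rule dependent_contains_circuit)
    have "\<not> C \<subseteq> zero_set y"
      using matroid_subset[OF M(1), of "zero_set y" C] B C(1)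
      unfolding matroid_bases_def circuits_def by auto
    then have e: "e \<in> C" "C - {e} \<subseteq> zero_set y"
      using C(2) by auto
    obtain a where a: "a \<in> C - {e}" "\<And>d. d \<in> C - {e} \<Longrightarrow> w $ a \<le> w $ d"
      using least_value_exists[OF circuit_minus_nonempty[OF M C(1)]] by blast
    show ?thesis
      using decomposition_value_fundamental_circuit[OF M w xy(1) C(1) e a]
        decomposition_value_fundamental_circuit[OF M w xy(2) C(1) e[unfolded eq] a] by simp
  qed
  then have "x = x'"
    by (simp add: vec_eq_iff)
  then show "x = x' \<and> y = y'"
    using sum by auto
qed

text \<open>
  Conversely, an nbc-basis \<open>B\<close> determines \<open>x\<close>: the superlevel set of \<open>x\<close> at \<open>t\<close> must be the flat spanned by
  the elements of \<open>B\<close> of \<open>w\<close>-value at least \<open>t\<close>. That \<open>x \<le> w\<close> says exactly that no element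
  outside \<open>B\<close> is the smallest element of its fundamental circuit.
\<close>

lemma nbc_basis_decomposition:
  fixes M :: "'e::finite set set"
  assumes M: "matroid M" "loopless M" and r: "linear_order r"
    and nbc: "B \<in> nbc_bases (value_order w r) M"
  obtains x y where "(x, y) \<in> decompositions M w" "B \<subseteq> zero_set y"
proof -
  have basis: "B \<in> matroid_bases M"
    using nbc unfolding nbc_bases_def by simp
  then have B: "B \<in> M" and maximal: "\<And>A. A \<in> M \<Longrightarrow> B \<subseteq> A \<Longrightarrow> A = B"
    unfolding matroid_bases_def by auto
  have single: "{e} \<in> M" for e
    using M(2) unfolding loopless_def by simp
  have "B \<noteq> {}"
    using maximal[OF single] by blast
  define up where "up t = {b \<in> B. t \<le> w $ b}" for t
  define S where "S e = {w $ b |b. b \<in> B \<and> insert e (up (w $ b)) \<notin> M}" for e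
  define x :: "real ^ 'e" where "x = (\<chi> e. if e \<in> B then w $ e else Max (S e))"
  define y where "y = w - x"
  have x_B: "x $ b = w $ b" if "b \<in> B" for b
    using that unfolding x_def by simp
  have up_B: "up t \<subseteq> B" for t
    unfolding up_def by auto
  have up_M: "up t \<in> M" for t
    using matroid_subset[OF M(1) B up_B] .
  have least_up: "\<exists>b\<in>B. t \<le> w $ b \<and> up (w $ b) = up t" if "up t \<noteq> {}" for t
  proof -
    obtain b where "b \<in> up t" "\<And>c. c \<in> up t \<Longrightarrow> w $ b \<le> w $ c"
      using least_value_exists[OF \<open>up t \<noteq> {}\<close>] by blast
    then show ?thesis
      unfolding up_def by (intro bexI[of _ b]) (auto intro: order_trans)
  qed
  have finite_S: "finite (S e)" for e
    by (rule finite_subset[where B = "(\<lambda>b. w $ b) ` B"]) (auto simp: S_def)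
  have dep: "t \<le> x $ e \<longleftrightarrow> insert e (up t) \<notin> M" if e: "e \<notin> B" for e t
  proof
    assume dep: "insert e (up t) \<notin> M"
    then have "up t \<noteq> {}"
      using single[of e] by auto
    then obtain b where b: "b \<in> B" "t \<le> w $ b" "up (w $ b) = up t"
      using least_up by blast
    then have "w $ b \<in> S e"
      using dep unfolding S_def by auto
    then have "w $ b \<le> Max (S e)"
      using finite_S by (rule Max_ge[rotated])
    then show "t \<le> x $ e"
      using b(2) e unfolding x_def by simp
  next
    assume le: "t \<le> x $ e"
    have "insert e B \<notin> M"
      using maximal[of "insert e B"] e by blast
    moreover obtain b where b: "b \<in> B" "\<And>c. c \<in> B \<Longrightarrow> w $ b \<le> w $ c"
      using least_value_exists[OF \<open>B \<noteq> {}\<close>] by blast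
    then have "up (w $ b) = B"
      unfolding up_def by auto
    ultimately have "w $ b \<in> S e"
      using b(1) unfolding S_def by auto
    then have "Max (S e) \<in> S e"
      using finite_S by (intro Max_in) auto
    then obtain c where c: "x $ e = w $ c" "insert e (up (w $ c)) \<notin> M"
      using e unfolding S_def x_def by auto
    then have "insert e (up (w $ c)) \<subseteq> insert e (up t)"
      using le unfolding up_def by auto
    then show "insert e (up t) \<notin> M"
      using matroid_subset[OF M(1)] c(2) by blast
  qed
  have flat: "{e. t \<le> x $ e} \<in> flats M" for t
  proof (rule flatI_independent[OF M(1) up_M[of t]])
    show "up t \<subseteq> {e. t \<le> x $ e}"
      using x_B unfolding up_def by auto
    show "f \<in> up t" if "f \<in> {e. t \<le> x $ e}" "insert f (up t) \<in> M" for f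
      using that dep[of f t] x_B[of f] unfolding up_def by (cases "f \<in> B") auto
    show "insert e (up t) \<in> M" if "e \<notin> {e. t \<le> x $ e}" for e
    proof (cases "e \<in> B")
      case True
      then have "insert e (up t) \<subseteq> B"
        using up_B by auto
      then show ?thesis
        by (rule matroid_subset[OF M(1) B])
    qed (use that dep[of e t] in auto)
  qed
  have y_B: "y $ b = 0" if "b \<in> B" for b
    using x_B[OF that] unfolding y_def by simp
  have y_nonneg: "0 \<le> y $ e" for e
  proof (cases "e \<in> B")
    case False
    have "insert e (up (x $ e)) \<notin> M"
      using dep[OF False, of "x $ e"] by simp
    then obtain C where C: "C \<in> circuits M" "C \<subseteq> insert e (up (x $ e))"
      by (rule dependent_contains_circuit)
    have "\<not> C \<subseteq> B"
      using matroid_subset[OF M(1) B, of C] C(1) unfolding circuits_def by auto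
    then have e: "e \<in> C" "C - {e} \<subseteq> B"
      using C(2) up_B by auto
    have "\<not> (\<forall>d\<in>C. (e, d) \<in> value_order w r)"
      using nbc C(1) e unfolding nbc_bases_def broken_circuits_def by blast
    then obtain d where d: "d \<in> C" "(e, d) \<notin> value_order w r"
      by auto
    have "(e, e) \<in> value_order w r"
      using linear_order_value_order[OF r, of w]
      unfolding linear_order_on_def partial_order_on_def preorder_on_def refl_on_def by auto
    then have "d \<noteq> e"
      using d(2) by auto
    then have "x $ e \<le> w $ d"
      using C(2) d(1) unfolding up_def by auto
    moreover have "w $ d \<le> w $ e"
      using d(2) unfolding value_order_def by auto
    ultimately show ?thesis
      unfolding y_def by simp
  qed (simp add: y_B)
  have flat_y: "A \<in> flats (uniform_matroid (CARD('e) - matroid_rank M UNIV + 1))"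
    if A: "A \<in> superlevel_sets y" for A
  proof -
    obtain t where t: "A = {e. t \<le> y $ e}" "A \<noteq> UNIV"
      using A by (rule superlevel_setsE)
    have "0 < t"
    proof (rule ccontr)
      assume "\<not> 0 < t"
      then have "A = UNIV"
        using y_nonneg t(1) by (auto intro: order_trans[of t 0])
      then show False
        using t(2) by simp
    qed
    then have "A \<subseteq> - B"
      using y_B unfolding t(1) by auto
    then have "card A \<le> card (- B)"
      by (intro card_mono) auto
    also have "\<dots> = CARD('e) - matroid_rank M UNIV"
      using basis matroid_bases_iff_card[OF M(1)]
      by (simp add: Compl_eq_Diff_UNIV card_Diff_subset)
    finally show ?thesis
      using proper_flat_uniform_iff[OF t(2)] by simp
  qed
  have "(x, y) \<in> decompositions M w"
    unfolding decompositions_def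
  proof (intro CollectI case_prodI conjI allI subsetI)
    show "x + y = w"
      unfolding y_def by simp
    show "A \<in> flats M" if "A \<in> superlevel_sets x" for A
      using that flat by (auto elim!: superlevel_setsE)
    show "\<exists>e. y $ e = 0"
      using y_B \<open>B \<noteq> {}\<close> by blast
  qed (fact flat_y y_nonneg)+
  moreover have "B \<subseteq> zero_set y"
    using y_B unfolding zero_set_def by auto
  ultimately show thesis
    by (rule that)
qed

theorem card_decompositions:
  fixes M :: "'e::finite set set"
  assumes M: "matroid M" "loopless M" and r: "linear_order r" and w: "generic_sum M w"
  shows "card (decompositions M w) = nbc r M"
proof -
  have "(\<lambda>(x, y). zero_set y) ` decompositions M w = nbc_bases (value_order w r) M"
  proof
    show "(\<lambda>(x, y). zero_set y) ` decompositions M w \<subseteq> nbc_bases (value_order w r) M"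
      using zero_set_nbc[OF M w] by auto
    show "nbc_bases (value_order w r) M \<subseteq> (\<lambda>(x, y). zero_set y) ` decompositions M w"
    proof
      fix B assume B: "B \<in> nbc_bases (value_order w r) M"
      obtain x y where xy: "(x, y) \<in> decompositions M w" "B \<subseteq> zero_set y"
        using nbc_basis_decomposition[OF M r B] .
      have "zero_set y = B"
        using decompositions_basis(1)[OF M w xy(1)] B xy(2)
        unfolding nbc_bases_def matroid_bases_def by blast
      then show "B \<in> (\<lambda>(x, y). zero_set y) ` decompositions M w"
        using xy(1) by force
    qed
  qed
  then have "bij_betw (\<lambda>(x, y). zero_set y) (decompositions M w) (nbc_bases (value_order w r) M)"
    using zero_set_inj_on_decompositions[OF M w] unfolding bij_betw_def by blast
  then have "card (decompositions M w) = nbc (value_order w r) M"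
    unfolding nbc_def by (rule bij_betw_same_card)
  also have "\<dots> = nbc r M"
    by (rule nbc_order_independent[OF M(1) linear_order_value_order[OF r] r])
  finally show ?thesis .
qed


section \<open>The stable intersection of the two fans\<close>

lemma generic_displacement_exists:
  fixes \<Sigma>1 \<Sigma>2 :: "(real ^ 'n::finite) wcomplex"
  assumes "finite (cells \<Sigma>1)" "finite (cells \<Sigma>2)"
  shows "\<exists>v. generic_displacement \<Sigma>1 \<Sigma>2 v"
proof -
  let ?P = "{(\<sigma>1, \<sigma>2) \<in> cells \<Sigma>1 \<times> cells \<Sigma>2. aff_dim (\<sigma>1 + \<sigma>2) < int CARD('n)}"
  have negl: "negligible (direction_space S)" if low: "aff_dim S < int CARD('n)" for S :: "(real ^ 'n) set"
  proof -
    have "aff_dim S < int DIM(real ^ 'n)"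
      using low by simp
    then obtain a b where ab: "a \<noteq> 0" "S \<subseteq> {x. a \<bullet> x = b}"
      by (rule aff_lowdim_subset_hyperplane)
    have "a \<bullet> x = b" if "x \<in> S" for x
      using ab(2) that by blast
    then have "{x - u |x u. x \<in> S \<and> u \<in> S} \<subseteq> {x. a \<bullet> x = 0}"
      by (auto simp: inner_diff_right)
    then have "direction_space S \<subseteq> {x. a \<bullet> x = 0}"
      unfolding direction_space_def using subspace_hyperplane by (rule span_minimal)
    then show ?thesis
      using negligible_subset[OF negligible_hyperplane[of a 0]] ab(1) by simp
  qed
  let ?D = "(\<lambda>(\<sigma>1, \<sigma>2). direction_space (\<sigma>1 + \<sigma>2)) ` ?P"
  have "finite ?P"
    by (rule finite_subset[of _ "cells \<Sigma>1 \<times> cells \<Sigma>2"]) (auto simp: assms)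
  then have "negligible (\<Union>?D)"
    using negl by (intro negligible_Union) auto
  then have "\<Union>?D \<noteq> UNIV"
    using non_negligible_UNIV by metis
  then obtain v where v: "v \<notin> \<Union>?D"
    by auto
  have "generic_displacement \<Sigma>1 \<Sigma>2 v"
    unfolding generic_displacement_def
  proof (intro ballI impI)
    fix \<sigma>1 \<sigma>2
    assume "\<sigma>1 \<in> cells \<Sigma>1" "\<sigma>2 \<in> cells \<Sigma>2" "aff_dim (\<sigma>1 + \<sigma>2) < int CARD('n)"
    then have "direction_space (\<sigma>1 + \<sigma>2) \<in> ?D"
      by (intro image_eqI[of _ _ "(\<sigma>1, \<sigma>2)"]) auto
    then show "v \<notin> direction_space (\<sigma>1 + \<sigma>2)"
      using v by auto
  qed
  then show ?thesis ..
qed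

lemma cells_Trop: "cells (Trop M) = chain_cone ` {F. proper_flat_chain M F}"
  unfolding Trop_def by auto

lemma cells_reflect_Trop:
  "cells (reflect (Trop M)) = (\<lambda>F. uminus ` chain_cone F) ` {F. proper_flat_chain M F}"
  unfolding reflect_def by (simp add: cells_Trop image_image)

lemma zero_mem_chain_cone: "0 \<in> chain_cone F"
  by (rule constant_mem_chain_cone) simp

lemma generic_displacement_sum:
  fixes M :: "'e::finite set set"
  assumes v: "generic_displacement (reflect (Trop M))
      (Trop (uniform_matroid (CARD('e) - matroid_rank M UNIV + 1))) v"
  shows "generic_sum M (- v)"
  unfolding generic_sum_def
proof (intro allI ballI impI)
  fix F G x y
  assume x: "x \<in> chain_cone F" and y: "y \<in> chain_cone G" and F: "proper_flat_chain M F"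
    and G: "proper_flat_chain (uniform_matroid (CARD('e) - matroid_rank M UNIV + 1)) G"
    and sum: "x + y = - v"
  let ?S = "uminus ` chain_cone F + chain_cone G"
  have "- x + 0 \<in> ?S"
    using x by (intro set_plus_intro imageI zero_mem_chain_cone)
  moreover have "- 0 + y \<in> ?S"
    using y by (intro set_plus_intro imageI zero_mem_chain_cone)
  ultimately have "(- x + 0) - (- 0 + y) \<in> direction_space ?S"
    unfolding direction_space_def by (intro span_base) blast
  moreover have "v = - (x + y)"
    using sum by (metis minus_minus)
  then have "(- x + 0) - (- 0 + y) = v"
    by simp
  ultimately have "\<not> aff_dim ?S < int CARD('e)"
    using v F G unfolding generic_displacement_def cells_Trop cells_reflect_Trop by auto
  moreover have "aff_dim ?S \<le> int CARD('e)"
    using aff_dim_le_DIM[of ?S] by simp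
  ultimately show "transversal_pair F G"
    unfolding transversal_pair_def by simp
qed

lemma transversal_pair_inter:
  fixes M :: "'e::finite set set"
  assumes M: "matroid M" "loopless M" and F: "proper_flat_chain M F"
    and G: "proper_flat_chain (uniform_matroid (CARD('e) - matroid_rank M UNIV + 1)) G"
    and T: "transversal_pair F G"
  shows "uminus ` chain_cone F \<inter> chain_cone G = span {char_vec UNIV}"
proof
  show "span {char_vec UNIV} \<subseteq> uminus ` chain_cone F \<inter> chain_cone G"
  proof
    fix z :: "real ^ 'e" assume "z \<in> span {char_vec UNIV}"
    then have const: "z $ e = z $ f" for e f
      unfolding mem_span_ones_iff by blast
    have "- z \<in> chain_cone F"
      by (rule constant_mem_chain_cone) (use const in simp)
    moreover have "z \<in> chain_cone G"
      using const by (rule constant_mem_chain_cone)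
    ultimately show "z \<in> uminus ` chain_cone F \<inter> chain_cone G"
      by (auto intro: image_eqI[of _ _ "- z"])
  qed
  show "uminus ` chain_cone F \<inter> chain_cone G \<subseteq> span {char_vec UNIV}"
  proof
    fix z assume "z \<in> uminus ` chain_cone F \<inter> chain_cone G"
    then obtain x where x: "x \<in> chain_cone F" "z = - x" and z: "z \<in> chain_cone G"
      by auto
    have "z $ e = z $ f" for e f
    proof -
      obtain b where b: "b \<in> - \<Union>G" "\<forall>A\<in>F. e \<in> A \<longleftrightarrow> b \<in> A"
        using transversal_basis_represents[OF M F G T, of e] by auto
      obtain c where c: "c \<in> - \<Union>G" "\<forall>A\<in>F. f \<in> A \<longleftrightarrow> c \<in> A"
        using transversal_basis_represents[OF M F G T, of f] by auto
      have "x $ e = x $ b" "x $ f = x $ c"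
        by (rule chain_cone_unseparated[OF x(1)]; use b c in auto)+
      moreover have "z $ b = z $ c"
        by (rule chain_cone_unseparated[OF z]) (use b(1) c(1) in auto)
      ultimately show ?thesis
        unfolding x(2) by simp
    qed
    then show "z \<in> span {char_vec UNIV}"
      unfolding mem_span_ones_iff by blast
  qed
qed

lemma lattice_index_integer_vectors: "lattice_index (integer_vectors :: (real ^ 'n::finite) set) = 1"
proof -
  let ?Z = "integer_vectors :: (real ^ 'n) set"
  have translate: "(+) z ` ?Z = ?Z" if z: "z \<in> ?Z" for z
  proof
    show "(+) z ` ?Z \<subseteq> ?Z"
      using z unfolding integer_vectors_def by auto
    show "?Z \<subseteq> (+) z ` ?Z"
    proof
      fix u assume "u \<in> ?Z"
      then have "u - z \<in> ?Z"
        using z unfolding integer_vectors_def by auto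
      then show "u \<in> (+) z ` ?Z"
        by (rule image_eqI[rotated]) simp
    qed
  qed
  have "0 \<in> ?Z"
    unfolding integer_vectors_def by simp
  then have "(\<lambda>z. (+) z ` ?Z) ` ?Z = {?Z}"
    using translate by auto
  then show ?thesis
    unfolding lattice_index_def by simp
qed

lemma sum_cell_lattices_subset: "cell_lattice S + cell_lattice T \<subseteq> integer_vectors"
  unfolding cell_lattice_def integer_vectors_def by (auto elim!: set_plus_elim)

lemma direction_space_uminus: "direction_space (uminus ` S) = direction_space S"
proof -
  have "{x - u |x u. x \<in> uminus ` S \<and> u \<in> uminus ` S} = {x - u |x u. x \<in> S \<and> u \<in> S}"
  proof (intro set_eqI iffI)
    fix z assume "z \<in> {x - u |x u. x \<in> uminus ` S \<and> u \<in> uminus ` S}"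
    then obtain x u where "x \<in> S" "u \<in> S" "z = u - x"
      by auto
    then show "z \<in> {x - u |x u. x \<in> S \<and> u \<in> S}"
      by blast
  next
    fix z assume "z \<in> {x - u |x u. x \<in> S \<and> u \<in> S}"
    then obtain x u where "x \<in> S" "u \<in> S" "z = (- u) - (- x)"
      by auto
    then show "z \<in> {x - u |x u. x \<in> uminus ` S \<and> u \<in> uminus ` S}"
      by blast
  qed
  then show ?thesis
    unfolding direction_space_def by simp
qed

text \<open>
  An integer vector \<open>z\<close> is split by giving every element the value of \<open>z\<close> at the basis element on
  its level set of \<open>x\<close>. The remainder vanishes on the basis, which is one level set of \<open>y\<close>, while the
  other level sets of \<open>y\<close> are singletons.
\<close>

lemma decompositions_lattice_index:
  fixes M :: "'e::finite set set"
  assumes M: "matroid M" "loopless M" and w: "generic_sum M w"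
    and xy: "(x, y) \<in> decompositions M w"
  shows "lattice_index (cell_lattice (uminus ` chain_cone (superlevel_sets x)) +
    cell_lattice (chain_cone (superlevel_sets y))) = 1"
proof -
  note props = decompositions_basis[OF M w xy]
  let ?N = "cell_lattice (uminus ` chain_cone (superlevel_sets x)) +
    cell_lattice (chain_cone (superlevel_sets y))"
  have "integer_vectors \<subseteq> ?N"
  proof
    fix z :: "real ^ 'e" assume z: "z \<in> integer_vectors"
    define rep where "rep e = (THE b. b \<in> zero_set y \<and> x $ e = x $ b)" for e
    have "\<exists>!b. b \<in> zero_set y \<and> x $ e = x $ b" for e
    proof (rule ex_ex1I)
      show "\<exists>b. b \<in> zero_set y \<and> x $ e = x $ b"
        using props(4)[of e] by blast
      show "b = c" if "b \<in> zero_set y \<and> x $ e = x $ b" "c \<in> zero_set y \<and> x $ e = x $ c" for b c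
        using props(2)[of b c] that by simp
    qed
    then have rep: "rep e \<in> zero_set y" "x $ e = x $ rep e" for e
      using theI'[of "\<lambda>b. b \<in> zero_set y \<and> x $ e = x $ b"] unfolding rep_def by blast+
    define p :: "real ^ 'e" where "p = (\<chi> e. z $ rep e)"
    have "p $ e = p $ f" if "x $ e = x $ f" for e f
      using that unfolding p_def rep_def by simp
    then have p: "p \<in> direction_space (uminus ` chain_cone (superlevel_sets x))"
      unfolding direction_space_uminus by (rule level_constant_mem_direction_space)
    have zero: "(z - p) $ b = 0" if b: "b \<in> zero_set y" for b
      using props(2)[OF rep(1)[of b] b] rep(2)[of b] unfolding p_def by simp
    have "(z - p) $ e = (z - p) $ f" if eq: "y $ e = y $ f" for e f
    proof (cases "e \<in> zero_set y")
      case True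
      then have "f \<in> zero_set y"
        using eq unfolding zero_set_def by simp
      then show ?thesis
        using zero True by simp
    next
      case False
      then have "f \<notin> zero_set y"
        using eq unfolding zero_set_def by simp
      then show ?thesis
        using props(3)[OF False _ eq] by simp
    qed
    then have q: "z - p \<in> direction_space (chain_cone (superlevel_sets y))"
      by (rule level_constant_mem_direction_space)
    have "p \<in> integer_vectors" "z - p \<in> integer_vectors"
      using z unfolding p_def integer_vectors_def by auto
    then have "p + (z - p) \<in> ?N"
      using p q unfolding cell_lattice_def by (intro set_plus_intro) auto
    then show "z \<in> ?N"
      by simp
  qed
  then have "?N = integer_vectors"
    using sum_cell_lattices_subset by blast
  then show ?thesis
    using lattice_index_integer_vectors by metis
qed

definition decomposition_cones ::
    "(real ^ 'e::finite) \<times> (real ^ 'e) \<Rightarrow> (real ^ 'e) set \<times> (real ^ 'e) set" where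
  "decomposition_cones =
     (\<lambda>(x, y). (uminus ` chain_cone (superlevel_sets x), chain_cone (superlevel_sets y)))"

lemma inj_on_decomposition_cones:
  assumes M: "matroid M" "loopless M" and w: "generic_sum M w"
  shows "inj_on decomposition_cones (decompositions M w)"
proof (rule inj_onI, clarify)
  fix x y x' y' assume xy: "(x, y) \<in> decompositions M w" and xy': "(x', y') \<in> decompositions M w"
    and eq: "decomposition_cones (x, y) = decomposition_cones (x', y')"
  have "chain_cone (superlevel_sets y) = chain_cone (superlevel_sets y')"
    using eq unfolding decomposition_cones_def by simp
  then have "y' \<in> chain_cone (superlevel_sets y)" "y \<in> chain_cone (superlevel_sets y')"
    using self_mem_chain_cone_superlevel by auto
  then have "y $ e \<le> y $ f \<longleftrightarrow> y' $ e \<le> y' $ f" for e f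
    unfolding mem_chain_cone_superlevel_iff by blast
  then have "zero_set y = zero_set y'"
    unfolding decompositions_zero_set[OF xy] decompositions_zero_set[OF xy']
      minima_eq_Compl_superlevel by simp
  then show "x = x' \<and> y = y'"
    using inj_onD[OF zero_set_inj_on_decompositions[OF M w], of "(x, y)" "(x', y')"] xy xy' by simp
qed

text \<open>
  The cones \<open>-\<sigma>\<^sub>F\<close> and \<open>\<sigma>\<^sub>G + \<epsilon> v\<close> meet if and only if \<open>-v\<close> is a sum of vectors of
  \<open>\<sigma>\<^sub>F\<close> and \<open>\<sigma>\<^sub>G\<close>, for one and equivalently for every positive \<open>\<epsilon>\<close>. The normalization
  \<open>min y = 0\<close> of a decomposition removes the lines of constant vectors.
\<close>

lemma displaced_cells_eq_decomposition_cones: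
  fixes M :: "'e::finite set set" and v :: "real ^ 'e"
  assumes M: "matroid M" "loopless M"
  defines "\<Sigma>1 \<equiv> reflect (Trop M)"
    and "\<Sigma>2 \<equiv> Trop (uniform_matroid (CARD('e) - matroid_rank M UNIV + 1))"
  assumes w: "generic_sum M (- v)"
  shows "{(\<tau>1, \<tau>2). \<tau>1 \<in> maximal_cells \<Sigma>1 \<and> \<tau>2 \<in> maximal_cells \<Sigma>2 \<and>
      span {char_vec UNIV} \<subseteq> \<tau>1 \<and> span {char_vec UNIV} \<subseteq> \<tau>2 \<and>
      (\<forall>\<^sub>F \<epsilon> in at_right (0::real). \<tau>1 \<inter> (+) (\<epsilon> *\<^sub>R v) ` \<tau>2 \<noteq> {})}
    = decomposition_cones ` decompositions M (- v)" (is "?P = ?D")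
proof
  show "?P \<subseteq> ?D"
  proof clarify
    fix \<tau>1 \<tau>2 assume max: "\<tau>1 \<in> maximal_cells \<Sigma>1" "\<tau>2 \<in> maximal_cells \<Sigma>2"
      and ev: "\<forall>\<^sub>F \<epsilon> in at_right (0::real). \<tau>1 \<inter> (+) (\<epsilon> *\<^sub>R v) ` \<tau>2 \<noteq> {}"
    obtain F where F: "proper_flat_chain M F" "\<tau>1 = uminus ` chain_cone F"
      using max(1) unfolding maximal_cells_def \<Sigma>1_def cells_reflect_Trop by auto
    obtain G where G: "proper_flat_chain (uniform_matroid (CARD('e) - matroid_rank M UNIV + 1)) G"
        "\<tau>2 = chain_cone G"
      using max(2) unfolding maximal_cells_def \<Sigma>2_def cells_Trop by auto
    have "\<forall>\<^sub>F \<epsilon> in at_right (0::real). 0 < \<epsilon> \<and> \<tau>1 \<inter> (+) (\<epsilon> *\<^sub>R v) ` \<tau>2 \<noteq> {}"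
      using ev eventually_at_right_less[of "0::real"] by eventually_elim simp
    then obtain \<epsilon> :: real where \<epsilon>: "0 < \<epsilon>" "\<tau>1 \<inter> (+) (\<epsilon> *\<^sub>R v) ` \<tau>2 \<noteq> {}"
      using eventually_happens'[OF trivial_limit_at_right_real] by blast
    then obtain s q where s: "s \<in> chain_cone F" and q: "q \<in> chain_cone G"
      and sq: "- s = \<epsilon> *\<^sub>R v + q"
      unfolding F(2) G(2) by blast
    obtain a where a: "\<And>e. q $ a \<le> q $ e"
      using least_value_exists[of UNIV q] by auto
    define c :: "real ^ 'e" where "c = (\<chi> e. q $ a)"
    define x where "x = (1 / \<epsilon>) *\<^sub>R (s + c)"
    define y where "y = (1 / \<epsilon>) *\<^sub>R (q - c)"
    have c: "c \<in> chain_cone F"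
      by (rule constant_mem_chain_cone) (simp add: c_def)
    have x: "x \<in> chain_cone F"
      unfolding x_def using s \<epsilon>(1)
      by (intro chain_cone_scaleR chain_cone_add c) auto
    have "- c \<in> chain_cone G"
      by (rule constant_mem_chain_cone) (simp add: c_def)
    then have "q + (- c) \<in> chain_cone G"
      using q by (intro chain_cone_add)
    then have y: "y \<in> chain_cone G"
      unfolding y_def using \<epsilon>(1) by (intro chain_cone_scaleR) auto
    have "s = - (\<epsilon> *\<^sub>R v + q)"
      using sq by (metis minus_minus)
    then have "s + q = \<epsilon> *\<^sub>R (- v)"
      by simp
    then have sum: "x + y = - v"
      unfolding x_def y_def using \<epsilon>(1) by (simp flip: scaleR_add_right)
    note eqs = generic_sum_determines_chains[OF M w F(1) G(1) x y sum]
    have "(x, y) \<in> decompositions M (- v)"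
      unfolding decompositions_def
    proof (intro CollectI case_prodI conjI allI)
      show "superlevel_sets x \<subseteq> flats M"
        "superlevel_sets y \<subseteq> flats (uniform_matroid (CARD('e) - matroid_rank M UNIV + 1))"
        using F(1) G(1) unfolding eqs proper_flat_chain_superlevel_iff by auto
      show "0 \<le> y $ e" for e
        using a[of e] \<epsilon>(1) unfolding y_def c_def by simp
      show "\<exists>e. y $ e = 0"
        by (rule exI[of _ a]) (simp add: y_def c_def)
    qed (fact sum)
    moreover have "(\<tau>1, \<tau>2) = decomposition_cones (x, y)"
      unfolding decomposition_cones_def F(2) G(2) using eqs by simp
    ultimately show "(\<tau>1, \<tau>2) \<in> ?D"
      by blast
  qed
  show "?D \<subseteq> ?P"
  proof
    fix t assume "t \<in> ?D"
    then obtain x y where xy: "(x, y) \<in> decompositions M (- v)" and t: "t = decomposition_cones (x, y)"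
      by auto
    note chains = decompositions_chains(1,2)[OF xy] and sum = decompositions_chains(3)[OF xy]
    note self = self_mem_chain_cone_superlevel
    let ?\<tau>1 = "uminus ` chain_cone (superlevel_sets x)"
    let ?\<tau>2 = "chain_cone (superlevel_sets y)"
    have "?\<tau>1 \<in> maximal_cells \<Sigma>1"
      unfolding maximal_cells_def
    proof (intro CollectI conjI ballI impI)
      show "?\<tau>1 \<in> cells \<Sigma>1"
        unfolding \<Sigma>1_def cells_reflect_Trop using chains(1) by auto
      fix \<tau> assume "\<tau> \<in> cells \<Sigma>1" and sub: "?\<tau>1 \<subseteq> \<tau>"
      then obtain F where F: "proper_flat_chain M F" "\<tau> = uminus ` chain_cone F"
        unfolding \<Sigma>1_def cells_reflect_Trop by auto
      have "- x \<in> \<tau>"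
        using sub self by blast
      then have "x \<in> chain_cone F"
        unfolding F(2) by auto
      then show "\<tau> = ?\<tau>1"
        unfolding F(2) using generic_sum_determines_chains(1)[OF M w F(1) chains(2) _ self sum] by simp
    qed
    moreover have "?\<tau>2 \<in> maximal_cells \<Sigma>2"
      unfolding maximal_cells_def
    proof (intro CollectI conjI ballI impI)
      show "?\<tau>2 \<in> cells \<Sigma>2"
        unfolding \<Sigma>2_def cells_Trop using chains(2) by auto
      fix \<tau> assume "\<tau> \<in> cells \<Sigma>2" and sub: "?\<tau>2 \<subseteq> \<tau>"
      then obtain G where G: "\<tau> = chain_cone G"
          "proper_flat_chain (uniform_matroid (CARD('e) - matroid_rank M UNIV + 1)) G"
        unfolding \<Sigma>2_def cells_Trop by auto
      have "y \<in> chain_cone G"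
        using sub self G by blast
      then show "\<tau> = ?\<tau>2"
        unfolding G using generic_sum_determines_chains(2)[OF M w chains(1) G(2) self _ sum] by simp
    qed
    moreover have "span {char_vec UNIV} \<subseteq> ?\<tau>1 \<inter> ?\<tau>2"
      using transversal_pair_inter[OF M chains decompositions_transversal[OF w xy]] by simp
    moreover have "\<forall>\<^sub>F \<epsilon> in at_right (0::real). ?\<tau>1 \<inter> (+) (\<epsilon> *\<^sub>R v) ` ?\<tau>2 \<noteq> {}"
      using eventually_at_right_less[of "0::real"]
    proof eventually_elim
      fix \<epsilon> :: real assume "0 < \<epsilon>"
      then have "\<epsilon> *\<^sub>R x \<in> chain_cone (superlevel_sets x)" "\<epsilon> *\<^sub>R y \<in> ?\<tau>2"
        by (auto intro: chain_cone_scaleR self)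
      moreover have "v = - (x + y)"
        using sum by (metis minus_minus)
      then have "- (\<epsilon> *\<^sub>R x) = \<epsilon> *\<^sub>R v + \<epsilon> *\<^sub>R y"
        by (simp add: scaleR_diff_right)
      ultimately show "?\<tau>1 \<inter> (+) (\<epsilon> *\<^sub>R v) ` ?\<tau>2 \<noteq> {}"
        by blast
    qed
    ultimately show "t \<in> ?P"
      unfolding t decomposition_cones_def by auto
  qed
qed

lemma displaced_multiplicity_eq_nbc:
  fixes M :: "'e::finite set set" and v :: "real ^ 'e"
  assumes M: "matroid M" "loopless M" and r: "linear_order r" and w: "generic_sum M (- v)"
  shows "displaced_multiplicity (reflect (Trop M))
      (Trop (uniform_matroid (CARD('e) - matroid_rank M UNIV + 1))) v (span {char_vec UNIV}) = nbc r M"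
proof -
  have "displaced_multiplicity (reflect (Trop M))
      (Trop (uniform_matroid (CARD('e) - matroid_rank M UNIV + 1))) v (span {char_vec UNIV})
    = (\<Sum>(\<tau>1, \<tau>2)\<in>decomposition_cones ` decompositions M (- v).
        lattice_index (cell_lattice \<tau>1 + cell_lattice \<tau>2))"
    unfolding displaced_multiplicity_def displaced_cells_eq_decomposition_cones[OF M w]
    by (simp add: reflect_def Trop_def)
  also have "\<dots> = (\<Sum>(\<tau>1, \<tau>2)\<in>decomposition_cones ` decompositions M (- v). 1)"
    using decompositions_lattice_index[OF M w]
    by (intro sum.cong) (auto simp: decomposition_cones_def)
  also have "\<dots> = card (decompositions M (- v))"
    using card_image[OF inj_on_decomposition_cones[OF M w]] by simp
  also have "\<dots> = nbc r M"
    by (rule card_decompositions[OF M r w])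
  finally show ?thesis .
qed


section \<open>The tropical intersection product\<close>

lemma lineality_meets_coordinate:
  fixes u :: "real ^ 'e::finite"
  shows "\<exists>z\<in>span {char_vec UNIV}. (u - z) $ \<epsilon> = 0"
  by (rule bexI[of _ "u $ \<epsilon> *\<^sub>R char_vec UNIV"]) (auto simp: char_vec_nth mem_span_ones_iff)

text \<open>
  The line of constant vectors and the coordinate hyperplane are complementary, over the integers as
  well, so every displacement makes them meet, with index one.
\<close>

lemma point_count_lineality_coordinate:
  fixes \<Sigma> :: "(real ^ 'e::finite) wcomplex"
  assumes L: "cells \<Sigma> = {span {char_vec UNIV}}"
  shows "weighted_point_count (stable_intersection \<Sigma> (Trop_coordinate \<epsilon>))
    = weight \<Sigma> (span {char_vec UNIV})"
proof -
  let ?L = "span {char_vec UNIV} :: (real ^ 'e) set"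
  let ?H = "{y :: real ^ 'e. y $ \<epsilon> = 0}"
  have inter: "?L \<inter> ?H = {0}"
  proof (intro set_eqI iffI)
    fix z assume z: "z \<in> ?L \<inter> ?H"
    then have "z $ e = z $ \<epsilon>" for e
      using mem_span_ones_iff[of z] by blast
    then show "z \<in> {0}"
      using z by (simp add: vec_eq_iff)
  qed (auto simp: span_zero)
  have "u \<in> ?L + ?H" for u
  proof -
    obtain z where "z \<in> ?L" "(u - z) $ \<epsilon> = 0"
      using lineality_meets_coordinate by blast
    then have "z + (u - z) \<in> ?L + ?H"
      by (intro set_plus_intro) auto
    then show ?thesis
      by simp
  qed
  then have UNIV: "?L + ?H = UNIV"
    by auto
  have cells: "cells (stable_intersection \<Sigma> (Trop_coordinate \<epsilon>)) = {{0}}"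
    unfolding stable_intersection_def using L inter UNIV
    by (simp add: Trop_coordinate_def)
  have max: "maximal_cells \<Sigma> = {?L}" "maximal_cells (Trop_coordinate \<epsilon>) = {?H}"
    unfolding maximal_cells_def L Trop_coordinate_def by auto
  have direction: "z \<in> direction_space S" if "z \<in> S" "0 \<in> S" for S and z :: "real ^ 'e"
    unfolding direction_space_def using that by (intro span_base) force
  have "integer_vectors \<subseteq> cell_lattice ?L + cell_lattice ?H"
  proof
    fix u :: "real ^ 'e" assume u: "u \<in> integer_vectors"
    define p :: "real ^ 'e" where "p = (\<chi> e. u $ \<epsilon>)"
    have "p \<in> integer_vectors" "u - p \<in> integer_vectors"
      using u unfolding p_def integer_vectors_def by auto
    moreover have "p \<in> ?L"
      unfolding mem_span_ones_iff p_def by simp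
    then have "p \<in> direction_space ?L"
      by (rule direction) (rule span_zero)
    moreover have "u - p \<in> direction_space ?H"
      by (rule direction) (auto simp: p_def)
    ultimately have "p + (u - p) \<in> cell_lattice ?L + cell_lattice ?H"
      unfolding cell_lattice_def by (intro set_plus_intro) auto
    then show "u \<in> cell_lattice ?L + cell_lattice ?H"
      by simp
  qed
  then have "cell_lattice ?L + cell_lattice ?H = integer_vectors"
    using sum_cell_lattices_subset by blast
  then have index: "lattice_index (cell_lattice ?L + cell_lattice ?H) = 1"
    using lattice_index_integer_vectors by metis
  have meet: "?L \<inter> (+) u ` ?H \<noteq> {}" for u
  proof -
    obtain z where z: "z \<in> ?L" "(u - z) $ \<epsilon> = 0"
      using lineality_meets_coordinate by blast
    then have "z - u \<in> ?H"
      by simp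
    then have "u + (z - u) \<in> (+) u ` ?H"
      by (rule imageI)
    then show ?thesis
      using z(1) by auto
  qed
  have "displaced_multiplicity \<Sigma> (Trop_coordinate \<epsilon>) v {0} = weight \<Sigma> ?L" for v
  proof -
    have pairs: "{(\<tau>1, \<tau>2). \<tau>1 \<in> maximal_cells \<Sigma> \<and> \<tau>2 \<in> maximal_cells (Trop_coordinate \<epsilon>) \<and>
        {0} \<subseteq> \<tau>1 \<and> {0} \<subseteq> \<tau>2 \<and>
        (\<forall>\<^sub>F \<epsilon> in at_right (0::real). \<tau>1 \<inter> (+) (\<epsilon> *\<^sub>R v) ` \<tau>2 \<noteq> {})} = {(?L, ?H)}"
      unfolding max using meet by (auto simp: span_zero)
    show ?thesis
      unfolding displaced_multiplicity_def pairs using index by (simp add: Trop_coordinate_def)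
  qed
  then have "weight (stable_intersection \<Sigma> (Trop_coordinate \<epsilon>)) {0} = weight \<Sigma> ?L"
    unfolding stable_intersection_def by simp
  then show ?thesis
    unfolding weighted_point_count_def cells by simp
qed

theorem proposition5p5:
  fixes M :: "'e::finite set set" and \<epsilon> :: 'e and r :: "'e rel" and k m :: nat
  assumes "matroid M" and "loopless M"
    and "matroid_rank M UNIV = k" and "CARD('e) = m"
    and "linear_order r"
  shows "tropical_product [reflect (Trop M), Trop (uniform_matroid (m - k + 1)), Trop_coordinate \<epsilon>]
           = nbc r M"
proof -
  let ?L = "span {char_vec UNIV} :: (real ^ 'e) set"
  let ?U = "uniform_matroid (CARD('e) - matroid_rank M UNIV + 1) :: 'e set set"
  note M = assms(1,2)
  define \<Sigma> where "\<Sigma> = stable_intersection (reflect (Trop M)) (Trop ?U)"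
  define v where "v = (SOME v. generic_displacement (reflect (Trop M)) (Trop ?U) v)"
  have "generic_displacement (reflect (Trop M)) (Trop ?U) v"
    unfolding v_def
    by (rule someI_ex, rule generic_displacement_exists) (simp_all add: cells_Trop cells_reflect_Trop)
  then have w: "generic_sum M (- v)"
    by (rule generic_displacement_sum)
  have weight: "weight \<Sigma> ?L = nbc r M"
    unfolding \<Sigma>_def stable_intersection_def
    using displaced_multiplicity_eq_nbc[OF M assms(5) w] unfolding v_def by simp
  have cells: "cells \<Sigma> = {?L |F G. proper_flat_chain M F \<and> proper_flat_chain ?U G \<and> transversal_pair F G}"
    (is "_ = ?C")
  proof (intro set_eqI iffI)
    fix \<sigma> assume "\<sigma> \<in> cells \<Sigma>"
    then obtain F G where "proper_flat_chain M F" "proper_flat_chain ?U G" "transversal_pair F G"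
      "\<sigma> = uminus ` chain_cone F \<inter> chain_cone G"
      unfolding \<Sigma>_def stable_intersection_def cells_Trop cells_reflect_Trop transversal_pair_def
      by auto
    then show "\<sigma> \<in> ?C"
      using transversal_pair_inter[OF M] by blast
  next
    fix \<sigma> assume "\<sigma> \<in> ?C"
    then obtain F G where FG: "proper_flat_chain M F" "proper_flat_chain ?U G" "transversal_pair F G"
      and \<sigma>: "\<sigma> = ?L"
      by blast
    have inter: "uminus ` chain_cone F \<inter> chain_cone G = ?L"
      by (rule transversal_pair_inter[OF M FG])
    then have "uminus ` chain_cone F \<inter> chain_cone G \<noteq> {}"
      using span_zero by blast
    then show "\<sigma> \<in> cells \<Sigma>"
      unfolding \<sigma> inter[symmetric] \<Sigma>_def stable_intersection_def cells_Trop cells_reflect_Trop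
      using FG unfolding transversal_pair_def by fastforce
  qed
  have product: "tropical_product [reflect (Trop M), Trop (uniform_matroid (m - k + 1)), Trop_coordinate \<epsilon>]
    = weighted_point_count (stable_intersection \<Sigma> (Trop_coordinate \<epsilon>))"
    unfolding tropical_product_def \<Sigma>_def using assms(3,4) by simp
  show ?thesis
  proof (cases "cells \<Sigma> = {}")
    (* The weight of the line is then meaningless, but no decomposition exists and the count is 0. *)
    case True
    have "decompositions M (- v) = {}"
    proof (rule ccontr)
      assume "decompositions M (- v) \<noteq> {}"
      then obtain x y where xy: "(x, y) \<in> decompositions M (- v)"
        by auto
      then have "?L \<in> cells \<Sigma>"
        unfolding cells
        using decompositions_chains(1,2)[OF xy] decompositions_transversal[OF w xy] by blast
      then show False
        using True by simp
    qed
    then have "nbc r M = 0"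
      using card_decompositions[OF M assms(5) w] by simp
    moreover have "cells (stable_intersection \<Sigma> (Trop_coordinate \<epsilon>)) = {}"
      unfolding stable_intersection_def using True by simp
    ultimately show ?thesis
      unfolding product weighted_point_count_def by simp
  next
    case False
    then have "cells \<Sigma> = {?L}"
      unfolding cells by blast
    then show ?thesis
      unfolding product using point_count_lineality_coordinate weight by metis
  qed
qed

end
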